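(* Let $\Omega\subset\mathbb{H}$ be a product domain, $\sigma\in\mathcal{SR}(\Omega)$ an idempotent and $\rho\in\mathcal{SEM}(\Omega)$. Then: (1) $\sigma*\rho\equiv 0$ if and only if there exist $I,J\in\mathbb{S}$ with $I\perp J$, $\alpha,\beta\in\mathcal{SEM}_{\mathbb{R}}(\Omega)$ and an invertible $f\in\mathcal{SEM}(\Omega)$ such that $\sigma=f*\ell^{+,I}*f^{-*}$ and $\rho=f*\ell^{-,I}*(\alpha+\beta J)*f^{-*}$. In particular, such a $\rho$ is an idempotent if and only if $\alpha=1$. (2) $\sigma*\rho*\sigma^c\equiv 0$ if and only if there exist $I,J\in\mathbb{S}$ with $I\perp J$, $\alpha_0,\alpha_1,\beta\in\mathcal{SEM}_{\mathbb{R}}(\Omega)$ and an invertible $f\in\mathcal{SEM}(\Omega)$ such that $\sigma=f*\ell^{+,I}*f^{-*}$ and $\rho=f*(\alpha_0+\alpha_1I+\beta\,\ell^{-,I}*J)*f^{-*}$. In particular, such a $\rho$ is an idempotent if and only if $\alpha_0=\frac12$ and $\alpha_1^{2}=-\frac14$. (3) $\sigma*\rho*\sigma\equiv 0$ if and only if there exist $I,J\in\mathbb{S}$ with $I\perp J$, $\alpha,\beta_2,\beta_3\in\mathcal{SEM}_{\mathbb{R}}(\Omega)$ and an invertible $f\in\mathcal{SEM}(\Omega)$ such that $\sigma=f*\ell^{+,I}*f^{-*}$ and $\rho=f*(\alpha\,\ell^{-,I}+(\beta_2+\beta_3I)*J)*f^{-*}$. In particular, such a $\rho$ is an idempotent if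 and only if $\alpha=1$ and $\beta_{2}^{2}+\beta_{3}^{2}\equiv0$.
   Context: $\mathbb{H}$ denotes the quaternions, $q^c$ the quaternionic conjugate, $\mathbb{S}=\{q\in\mathbb{H}: q^2=-1\}$, and $\mathbb{C}_I=\mathbb{R}+I\mathbb{R}$ for $I\in\mathbb{S}$. For $q=x+Iy$ put $\mathbb{S}_q=\{x+Jy: J\in\mathbb{S}\}$. A domain (connected open set) $\Omega\subset\mathbb{H}$ is circular if $\mathbb{S}_q\subset\Omega$ for all $q\in\Omega$; a circular domain is a product domain if $\Omega\cap\mathbb{R}=\emptyset$. A function $f$ on a circular open set $\Omega$ is slice regular ($f\in\mathcal{SR}(\Omega)$) if $f(x+Iy)=F_1(x,y)+IF_2(x,y)$ for all $x+Iy\in\Omega$ ($x,y\in\mathbb{R}$, $I\in\mathbb{S}$), with $\mathbb{H}$-valued $F_1$ even in $y$ and $F_2$ odd in $y$, and each restriction $f|_{\Omega\cap\mathbb{C}_I}$ is real differentiable with $\frac12(\partial_x+I\partial_y)f|_{\Omega\cap\mathbb{C}_I}\equiv0$. The $*$-product is $(f*g)(q)=0$ if $f(q)=0$ and $(f*g)(q)=f(q)\,g(f(q)^{-1}qf(q))$ otherwise. $f$ is slice preserving if $f(\Omega\cap\mathbb{C}_I)\subset\mathbb{C}_I$ for every $I\in\mathbb{S}$. A function $f$ is slice semi-regular on $\Omega$ ($f\in\mathcal{SEM}(\Omega)$) if there is a circular open $\widetilde\Omega\subseteq\Omega$ with $f\in\mathcal{SR}(\widetilde\Omega)$ and each point of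 $\Omega\setminus\widetilde\Omega$ is a pole or a removable singularity; i.e. $\Omega\setminus\widetilde\Omega$ consists of isolated real points and isolated spheres $\mathbb{S}_p$, near each of which $\Delta_p^m f$ extends slice regularly for some integer $m\ge0$, where $\Delta_p(q)=q^2-2\mathrm{Re}(p)q+|p|^2$. Functions agreeing where both are defined are identified. $\mathcal{SEM}_{\mathbb{R}}(\Omega)$ is the subset of slice preserving elements; it is a field and the center of the algebra $(\mathcal{SEM}(\Omega),+,* )$, which is a 4-dimensional vector space over it: for an orthonormal basis $(1,I,J,K)$ of $\mathbb{H}$, each $f$ is uniquely $f_0+f_1I+f_2J+f_3K$ with $f_\ell\in\mathcal{SEM}_{\mathbb{R}}(\Omega)$. Set $f^c=f_0-(f_1I+f_2J+f_3K)$, $f^s=f*f^c=f_0^2+f_1^2+f_2^2+f_3^2$. $f$ is $*$-invertible iff $f^s\not\equiv0$, with $f^{-*}=(f^s)^{-1}f^c$. An idempotent is $\sigma\not\equiv0,1$ with $\sigma*\sigma=\sigma$. $\mathcal{J}(q)=q_v/|q_v|$ on $\mathbb{H}\setminus\mathbb{R}$ ($q_v$ the imaginary part of $q$); it is slice preserving slice regular with $\mathcal{J}^2=-1$. For $I\in\mathbb{S}$, $\ell^{+,I}=\frac{1-\mathcal{J}I}{2}$ and $\ell^{-,I}=\frac{1+\mathcal{J}I}{2}$ on the product domain $\Omega$. *)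

theory Defs
  imports "HOL-Analysis.Analysis" "HOL-Library.Function_Algebras"
begin

section \<open>Quaternions\<close>

datatype quat = Quat (re: real) (im1: real) (im2: real) (im3: real)

lemma quat_eq_iff: "x = y \<longleftrightarrow> re x = re y \<and> im1 x = im1 y \<and> im2 x = im2 y \<and> im3 x = im3 y"
  by (cases x; cases y) auto

instantiation quat :: ab_group_add
begin
definition "0 = Quat 0 0 0 0"
definition "x + y = Quat (re x + re y) (im1 x + im1 y) (im2 x + im2 y) (im3 x + im3 y)"
definition "x - y = Quat (re x - re y) (im1 x - im1 y) (im2 x - im2 y) (im3 x - im3 y)"
definition "- x = Quat (- re x) (- im1 x) (- im2 x) (- im3 x)"
instance
  by standard
    (simp_all add: quat_eq_iff zero_quat_def plus_quat_def minus_quat_def uminus_quat_def)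
end

instantiation quat :: real_vector
begin
definition "scaleR r x = Quat (r * re x) (r * im1 x) (r * im2 x) (r * im3 x)"
instance
  by standard (simp_all add: quat_eq_iff plus_quat_def scaleR_quat_def algebra_simps)
end

instantiation quat :: real_algebra_1
begin
definition "1 = Quat 1 0 0 0"
definition "x * y = Quat
  (re x * re y - im1 x * im1 y - im2 x * im2 y - im3 x * im3 y)
  (re x * im1 y + im1 x * re y + im2 x * im3 y - im3 x * im2 y)
  (re x * im2 y - im1 x * im3 y + im2 x * re y + im3 x * im1 y)
  (re x * im3 y + im1 x * im2 y - im2 x * im1 y + im3 x * re y)"
instance
  by standard
    (simp_all add: quat_eq_iff zero_quat_def one_quat_def plus_quat_def scaleR_quat_def
       times_quat_def algebra_simps)
end

lemma quat_sel [simp]: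
  "re 0 = 0" "im1 0 = 0" "im2 0 = 0" "im3 0 = 0"
  "re 1 = 1" "im1 1 = 0" "im2 1 = 0" "im3 1 = 0"
  "re (x + y) = re x + re y" "im1 (x + y) = im1 x + im1 y"
  "im2 (x + y) = im2 x + im2 y" "im3 (x + y) = im3 x + im3 y"
  "re (x - y) = re x - re y" "im1 (x - y) = im1 x - im1 y"
  "im2 (x - y) = im2 x - im2 y" "im3 (x - y) = im3 x - im3 y"
  "re (- x) = - re x" "im1 (- x) = - im1 x" "im2 (- x) = - im2 x" "im3 (- x) = - im3 x"
  "re (r *\<^sub>R x) = r * re x" "im1 (r *\<^sub>R x) = r * im1 x"
  "im2 (r *\<^sub>R x) = r * im2 x" "im3 (r *\<^sub>R x) = r * im3 x"
  "re (x * y) = re x * re y - im1 x * im1 y - im2 x * im2 y - im3 x * im3 y"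
  "im1 (x * y) = re x * im1 y + im1 x * re y + im2 x * im3 y - im3 x * im2 y"
  "im2 (x * y) = re x * im2 y - im1 x * im3 y + im2 x * re y + im3 x * im1 y"
  "im3 (x * y) = re x * im3 y + im1 x * im2 y - im2 x * im1 y + im3 x * re y"
  by (simp_all add: zero_quat_def one_quat_def plus_quat_def minus_quat_def uminus_quat_def
        scaleR_quat_def times_quat_def)

lemma quat_sel_of_real [simp]:
  "re (of_real r) = r" "im1 (of_real r) = 0" "im2 (of_real r) = 0" "im3 (of_real r) = 0"
  by (simp_all add: of_real_def)

definition qcnj :: "quat \<Rightarrow> quat"
  where "qcnj x = Quat (re x) (- im1 x) (- im2 x) (- im3 x)"

instantiation quat :: real_inner
begin
definition "inner x y = re x * re y + im1 x * im1 y + im2 x * im2 y + im3 x * im3 y"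
definition "norm (x :: quat) = sqrt (inner x x)"
definition "sgn (x :: quat) = x /\<^sub>R norm x"
definition "dist x y = norm (x - y :: quat)"
definition "(uniformity :: (quat \<times> quat) filter) =
  (INF e\<in>{0 <..}. principal {(x, y). dist x y < e})"
definition "open (U :: quat set) \<longleftrightarrow>
  (\<forall>x\<in>U. eventually (\<lambda>(x', y). x' = x \<longrightarrow> y \<in> U) uniformity)"
instance
proof
  fix x y z :: quat and r :: real and U :: "quat set"
  show "inner x x = 0 \<longleftrightarrow> x = 0"
    by (simp add: inner_quat_def quat_eq_iff add_nonneg_eq_0_iff)
qed (simp_all add: inner_quat_def norm_quat_def sgn_quat_def dist_quat_def
       uniformity_quat_def open_quat_def algebra_simps)
end

lemma norm_quat: "norm x = sqrt ((re x)\<^sup>2 + (im1 x)\<^sup>2 + (im2 x)\<^sup>2 + (im3 x)\<^sup>2)"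
  by (simp add: norm_quat_def inner_quat_def power2_eq_square)

instantiation quat :: real_normed_div_algebra
begin
definition "inverse x = qcnj x /\<^sub>R (norm x)\<^sup>2"
definition "x div y = x * inverse (y :: quat)"
instance
proof
  fix x y :: quat
  have nz: "(re x)\<^sup>2 + (im1 x)\<^sup>2 + (im2 x)\<^sup>2 + (im3 x)\<^sup>2 \<noteq> 0" if "x \<noteq> 0"
    using that by (auto simp: quat_eq_iff add_nonneg_eq_0_iff)
  have sq: "(norm x)\<^sup>2 = (re x)\<^sup>2 + (im1 x)\<^sup>2 + (im2 x)\<^sup>2 + (im3 x)\<^sup>2"
    by (simp add: norm_quat)
  have "x * qcnj x = of_real ((norm x)\<^sup>2)" "qcnj x * x = of_real ((norm x)\<^sup>2)"
    unfolding sq by (simp_all add: quat_eq_iff qcnj_def power2_eq_square)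
  then show "x \<noteq> 0 \<Longrightarrow> inverse x * x = 1" "x \<noteq> 0 \<Longrightarrow> x * inverse x = 1"
    by (simp_all add: inverse_quat_def of_real_def)
  show "x div y = x * inverse y" by (simp add: divide_quat_def)
  show "inverse (0 :: quat) = 0" by (simp add: inverse_quat_def)
  show "norm (x * y) = norm x * norm y"
    unfolding norm_quat real_sqrt_mult [symmetric]
    by (rule arg_cong [where f = sqrt]) (simp add: power2_eq_square algebra_simps)
qed
end

definition qvec :: "quat \<Rightarrow> quat"
  where "qvec q = Quat 0 (im1 q) (im2 q) (im3 q)"

definition imag_units :: "quat set"  ("\<S>")
  where "\<S> = {q. q\<^sup>2 = - 1}"

definition slice :: "quat \<Rightarrow> quat set"
  where "slice I = {of_real x + I * of_real y | x y. True}"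

text \<open>The set of all \<open>x + J y\<close> with \<open>J\<close> an imaginary unit, for \<open>q = x + I y\<close>; it is \<open>{q}\<close> when
  \<open>q\<close> is real.  It does not depend on the sign of \<open>y\<close>, so \<open>y = norm (qvec q)\<close> is taken.\<close>
definition slice_sphere :: "quat \<Rightarrow> quat set"
  where "slice_sphere q = {of_real (re q) + J * of_real (norm (qvec q)) | J. J \<in> \<S>}"

definition circular :: "quat set \<Rightarrow> bool"
  where "circular A \<longleftrightarrow> (\<forall>q\<in>A. slice_sphere q \<subseteq> A)"

definition circular_domain :: "quat set \<Rightarrow> bool"
  where "circular_domain \<Omega> \<longleftrightarrow> open \<Omega> \<and> connected \<Omega> \<and> \<Omega> \<noteq> {} \<and> circular \<Omega>"

definition product_domain :: "quat set \<Rightarrow> bool"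
  where "product_domain \<Omega> \<longleftrightarrow> circular_domain \<Omega> \<and> \<Omega> \<inter> \<real> = {}"


section \<open>Slice regular functions\<close>

text \<open>Functions on a subset of the quaternions are represented by total functions; the values
  outside the set under consideration are irrelevant.  The operations \<open>+\<close>, \<open>-\<close>, \<open>0\<close>, \<open>1\<close>
  on functions are the pointwise ones of \<open>Function_Algebras\<close>.  Membership in \<open>SR A\<close> is meaningful
  for circular open \<open>A\<close>.\<close>

definition slice_function :: "quat set \<Rightarrow> (quat \<Rightarrow> quat) \<Rightarrow> bool"
  where "slice_function A f \<longleftrightarrow>
    (\<exists>F1 F2 :: real \<Rightarrow> real \<Rightarrow> quat.
      (\<forall>x y. F1 x (- y) = F1 x y \<and> F2 x (- y) = - F2 x y) \<and>
      (\<forall>x y. \<forall>I\<in>\<S>. of_real x + I * of_real y \<in> A \<longrightarrow>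
         f (of_real x + I * of_real y) = F1 x y + I * F2 x y))"

definition SR :: "quat set \<Rightarrow> (quat \<Rightarrow> quat) set"
  where "SR A = {f. slice_function A f \<and>
    (\<forall>I\<in>\<S>. \<forall>x y. of_real x + I * of_real y \<in> A \<longrightarrow>
      (\<exists>D. ((\<lambda>(s, t). f (of_real s + I * of_real t)) has_derivative D) (at (x, y)) \<and>
           (1 / 2) *\<^sub>R (D (1, 0) + I * D (0, 1)) = 0))}"

definition slice_preserving :: "quat set \<Rightarrow> (quat \<Rightarrow> quat) \<Rightarrow> bool"
  where "slice_preserving A f \<longleftrightarrow> (\<forall>I\<in>\<S>. f ` (A \<inter> slice I) \<subseteq> slice I)"

definition star :: "(quat \<Rightarrow> quat) \<Rightarrow> (quat \<Rightarrow> quat) \<Rightarrow> quat \<Rightarrow> quat"  (infixl "\<star>" 70)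
  where "(f \<star> g) q = (if f q = 0 then 0 else f q * g (inverse (f q) * q * f q))"


section \<open>Slice semi-regular functions\<close>

definition qDelta :: "quat \<Rightarrow> quat \<Rightarrow> quat"
  where "qDelta p q = q\<^sup>2 - of_real (2 * re p) * q + of_real ((norm p)\<^sup>2)"

text \<open>The sphere of \<open>p\<close> (a single point if \<open>p\<close> is real) is isolated in the complement of \<open>W\<close>,
  and near it \<open>(\<Delta>\<^sub>p)\<^sup>m f\<close> extends slice regularly.  The case \<open>m = 0\<close> is that of a
  removable singularity.  As \<open>\<Delta>\<^sub>p\<close> is slice preserving, the \<open>*\<close>-product of
  \<open>(\<Delta>\<^sub>p)\<^sup>m\<close> and \<open>f\<close> is the pointwise one.\<close>
definition pole_or_removable :: "quat set \<Rightarrow> quat set \<Rightarrow> (quat \<Rightarrow> quat) \<Rightarrow> quat \<Rightarrow> bool"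
  where "pole_or_removable \<Omega> W f p \<longleftrightarrow>
    (\<exists>U. open U \<and> circular U \<and> slice_sphere p \<subseteq> U \<and> U \<subseteq> \<Omega> \<and> U - slice_sphere p \<subseteq> W \<and>
      (\<exists>m::nat. \<exists>g\<in>SR U. \<forall>q\<in>U - slice_sphere p. g q = (qDelta p q) ^ m * f q))"

definition semi_regular_with :: "quat set \<Rightarrow> quat set \<Rightarrow> (quat \<Rightarrow> quat) \<Rightarrow> bool"
  where "semi_regular_with \<Omega> W f \<longleftrightarrow>
    W \<subseteq> \<Omega> \<and> open W \<and> circular W \<and> f \<in> SR W \<and> (\<forall>p\<in>\<Omega> - W. pole_or_removable \<Omega> W f p)"

definition SEM :: "quat set \<Rightarrow> (quat \<Rightarrow> quat) set"
  where "SEM \<Omega> = {f. \<exists>W. semi_regular_with \<Omega> W f}"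

definition SEM_R :: "quat set \<Rightarrow> (quat \<Rightarrow> quat) set"
  where "SEM_R \<Omega> = {f. \<exists>W. semi_regular_with \<Omega> W f \<and> slice_preserving W f}"

text \<open>Elements of \<open>SEM \<Omega>\<close> are representatives; semi-regular functions that agree where both
  are defined are identified.  All equalities between semi-regular functions are meant with
  respect to this relation.\<close>
definition sem_eq :: "quat set \<Rightarrow> (quat \<Rightarrow> quat) \<Rightarrow> (quat \<Rightarrow> quat) \<Rightarrow> bool"
  where "sem_eq \<Omega> f g \<longleftrightarrow>
    (\<exists>V W. semi_regular_with \<Omega> V f \<and> semi_regular_with \<Omega> W g \<and> (\<forall>q\<in>V \<inter> W. f q = g q))"

abbreviation sem_eq_infix  ("(_/ \<simeq>\<^bsub>_\<^esub> _)" [51, 0, 51] 50)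
  where "f \<simeq>\<^bsub>\<Omega>\<^esub> g \<equiv> sem_eq \<Omega> f g"

abbreviation cst :: "quat \<Rightarrow> quat \<Rightarrow> quat"
  where "cst c \<equiv> (\<lambda>_. c)"

text \<open>The components are taken with respect to the standard basis; \<open>f\<^sup>c\<close> does not depend on
  the orthonormal basis \<open>(1, I, J, K)\<close>.  The components are unique up to the identification, so
  \<open>SOME\<close> only chooses a representative.\<close>
definition reg_conj :: "quat set \<Rightarrow> (quat \<Rightarrow> quat) \<Rightarrow> quat \<Rightarrow> quat"
  where "reg_conj \<Omega> f = (SOME g. \<exists>f0\<in>SEM_R \<Omega>. \<exists>f1\<in>SEM_R \<Omega>. \<exists>f2\<in>SEM_R \<Omega>. \<exists>f3\<in>SEM_R \<Omega>.
    (f \<simeq>\<^bsub>\<Omega>\<^esub> f0 + (f1 \<star> cst (Quat 0 1 0 0) + f2 \<star> cst (Quat 0 0 1 0) + f3 \<star> cst (Quat 0 0 0 1))) \<and>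
    g = f0 - (f1 \<star> cst (Quat 0 1 0 0) + f2 \<star> cst (Quat 0 0 1 0) + f3 \<star> cst (Quat 0 0 0 1)))"

definition reg_symm :: "quat set \<Rightarrow> (quat \<Rightarrow> quat) \<Rightarrow> quat \<Rightarrow> quat"
  where "reg_symm \<Omega> f = f \<star> reg_conj \<Omega> f"

definition star_invertible :: "quat set \<Rightarrow> (quat \<Rightarrow> quat) \<Rightarrow> bool"
  where "star_invertible \<Omega> f \<longleftrightarrow>
    f \<in> SEM \<Omega> \<and> (\<exists>g\<in>SEM \<Omega>. (f \<star> g \<simeq>\<^bsub>\<Omega>\<^esub> 1) \<and> (g \<star> f \<simeq>\<^bsub>\<Omega>\<^esub> 1))"

text \<open>\<open>f\<^sup>s\<close> is slice preserving, so its inverse in the field of slice preserving semi-regular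
  functions is the pointwise reciprocal.\<close>
definition star_inv :: "quat set \<Rightarrow> (quat \<Rightarrow> quat) \<Rightarrow> quat \<Rightarrow> quat"
  where "star_inv \<Omega> f = (\<lambda>q. inverse (reg_symm \<Omega> f q)) \<star> reg_conj \<Omega> f"

definition star_idempotent :: "quat set \<Rightarrow> (quat \<Rightarrow> quat) \<Rightarrow> bool"
  where "star_idempotent \<Omega> f \<longleftrightarrow>
    f \<in> SEM \<Omega> \<and> \<not> (f \<simeq>\<^bsub>\<Omega>\<^esub> 0) \<and> \<not> (f \<simeq>\<^bsub>\<Omega>\<^esub> 1) \<and> (f \<star> f \<simeq>\<^bsub>\<Omega>\<^esub> f)"

definition Jfun :: "quat \<Rightarrow> quat"
  where "Jfun q = qvec q /\<^sub>R norm (qvec q)"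

text \<open>Left \<open>*\<close>-multiplication by a slice preserving function and right \<open>*\<close>-multiplication by a
  constant are pointwise, so \<open>Jfun \<star> cst I\<close> is \<open>\<lambda>q. Jfun q * I\<close>.\<close>
definition ell_plus :: "quat \<Rightarrow> quat \<Rightarrow> quat"
  where "ell_plus I = (\<lambda>q. (1 - Jfun q * I) / 2)"

definition ell_minus :: "quat \<Rightarrow> quat \<Rightarrow> quat"
  where "ell_minus I = (\<lambda>q. (1 + Jfun q * I) / 2)"

end

theory Submission
  imports Defs "HOL-Complex_Analysis.Complex_Analysis"
begin

text \<open>
  Every sphere of a product domain meets each slice in two conjugate points, so the spheres are
  parametrised by a connected open subset \<open>D\<close> of the upper half plane.  A slice function
  \<open>f (x + I y) = F1 x y + I * F2 x y\<close> is the same as its stem \<open>F1 + \<iota> F2\<close>, a function on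
  \<open>D\<close> with values in the biquaternions, the quaternions with complex coefficients.  Evaluation on
  the slice of \<open>I\<close> sends the imaginary unit \<open>\<iota>\<close> of the coefficients to \<open>I\<close>.  In terms of stems
  all notions become classical: the \<open>*\<close>-product is the pointwise product of biquaternions
  (\<open>stem_star\<close>), slice regularity is holomorphy (\<open>SR_imp_biholo_stem\<close>, \<open>biholo_imp_SR\<close>),
  semi-regularity is meromorphy (\<open>semi_regular_imp_bimero\<close>, \<open>bimero_imp_semi_regular\<close>), slice
  preserving functions are the scalar ones, \<open>Jfun\<close> is the constant \<open>\<iota>\<close>, and the identification of
  semi-regular functions is equality outside a set that is sparse in \<open>D\<close> (\<open>sem_eq_iff\<close>).
  Semi-regular functions are thus the split quaternion algebra over the field of meromorphic
  functions on \<open>D\<close>, that is, two by two matrices over that field.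

  The theorem is then linear algebra.  An idempotent \<open>\<sigma>\<close> other than 0 and 1 has scalar part 1/2, so it
  has rank one and is conjugate to the constant idempotent \<open>lp\<close>, the stem of \<open>ell_plus i\<close>
  (\<open>intertwiner\<close>).  The same conjugation turns \<open>\<sigma>\<^sup>c\<close> into \<open>lm\<close>, the stem of \<open>ell_minus i\<close>, and
  the three equations for \<open>\<rho>\<close> into \<open>lp X = 0\<close>, \<open>lp X lm = 0\<close> and \<open>lp X lp = 0\<close>, whose solutions
  can be read off the four components (\<open>annihilated_iff_form\<close>).  An arbitrary orthogonal pair \<open>I\<close>,
  \<open>J\<close> of imaginary units satisfies the same relations as \<open>i\<close>, \<open>j\<close>, so there is an automorphism of
  the biquaternions carrying one pair to the other (\<open>biframe_mult\<close>).  Finally, each normal form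
  squares to itself at a point exactly if the asserted condition holds there or the form is 0 or 1
  there; as a meromorphic function on \<open>D\<close> is generically equal to a given constant or generically
  different from it, the second alternative would make \<open>\<rho>\<close> one of the trivial idempotents
  (\<open>nontrivial_idempotent_alternative\<close>).
\<close>

section \<open>Slices of the quaternions\<close>

abbreviation qi :: quat where "qi \<equiv> Quat 0 1 0 0"
abbreviation qj :: quat where "qj \<equiv> Quat 0 0 1 0"
abbreviation qk :: quat where "qk \<equiv> Quat 0 0 0 1"

lemma imag_units_iff:
  "I \<in> \<S> \<longleftrightarrow> re I = 0 \<and> (im1 I)\<^sup>2 + (im2 I)\<^sup>2 + (im3 I)\<^sup>2 = 1"
proof
  assume "I \<in> \<S>"
  then have *: "re I * re I - im1 I * im1 I - im2 I * im2 I - im3 I * im3 I = -1"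
    "re I * im1 I = 0" "re I * im2 I = 0" "re I * im3 I = 0"
    by (auto simp: imag_units_def power2_eq_square quat_eq_iff)
  have "re I = 0"
  proof (rule ccontr)
    assume "re I \<noteq> 0"
    with * have "re I * re I = -1" by simp
    then show False
      by (metis not_one_le_zero neg_0_le_iff_le zero_le_square)
  qed
  with * show "re I = 0 \<and> (im1 I)\<^sup>2 + (im2 I)\<^sup>2 + (im3 I)\<^sup>2 = 1"
    by (simp add: power2_eq_square)
qed (simp add: imag_units_def power2_eq_square quat_eq_iff)

lemma imag_units_square: "I \<in> \<S> \<Longrightarrow> I * I = - 1"
  by (simp add: imag_units_def power2_eq_square)

lemma qi_imag_unit [simp]: "qi \<in> \<S>" and qj_imag_unit [simp]: "qj \<in> \<S>"
  by (simp_all add: imag_units_iff)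

lemma uminus_imag_unit: "I \<in> \<S> \<Longrightarrow> - I \<in> \<S>"
  by (simp add: imag_units_iff)

lemma conjugate_imag_unit: "u \<noteq> 0 \<Longrightarrow> I \<in> \<S> \<Longrightarrow> inverse u * I * u \<in> \<S>" for u :: quat
  by (simp add: imag_units_def power2_eq_square mult.assoc)
     (metis (no_types, lifting) mult.assoc mult_minus1_right mult_minus_left left_inverse
        right_inverse mult_1_left)

text \<open>The field embedding of the complex numbers onto the slice of \<open>I\<close>.\<close>
definition slice_embed :: "quat \<Rightarrow> complex \<Rightarrow> quat"
  where "slice_embed I c = Re c *\<^sub>R 1 + Im c *\<^sub>R I"

lemma slice_embed_Complex: "slice_embed I (Complex x y) = of_real x + I * of_real y"
  by (simp add: slice_embed_def quat_eq_iff)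

lemma slice_embed_add: "slice_embed I (a + b) = slice_embed I a + slice_embed I b"
  and slice_embed_diff: "slice_embed I (a - b) = slice_embed I a - slice_embed I b"
  and slice_embed_0 [simp]: "slice_embed I 0 = 0"
  and slice_embed_1 [simp]: "slice_embed I 1 = 1"
  and slice_embed_of_real: "slice_embed I (of_real r) = of_real r"
  and slice_embed_ii [simp]: "slice_embed I \<i> = I"
  by (simp_all add: slice_embed_def algebra_simps of_real_def)

lemma slice_embed_cnj: "slice_embed I (cnj z) = slice_embed (- I) z"
  by (simp add: slice_embed_def)

lemma slice_embed_mult:
  "I \<in> \<S> \<Longrightarrow> slice_embed I (a * b) = slice_embed I a * slice_embed I b"
  by (simp add: slice_embed_def algebra_simps imag_units_square)

lemma slice_embed_power: "I \<in> \<S> \<Longrightarrow> slice_embed I (a ^ n) = slice_embed I a ^ n"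
  by (induction n) (simp_all add: slice_embed_mult)

lemma slice_embed_inverse:
  assumes "I \<in> \<S>" shows "slice_embed I (inverse a) = inverse (slice_embed I a)"
proof (cases "a = 0")
  case False
  then have "slice_embed I a * slice_embed I (inverse a) = 1"
    by (simp flip: slice_embed_mult [OF assms])
  then show ?thesis
    by (metis inverse_unique)
qed simp

text \<open>Conjugation by \<open>u\<close> moves a point within its sphere: only the imaginary unit changes.\<close>
lemma slice_embed_conjugate:
  assumes "u \<noteq> 0"
  shows "inverse u * slice_embed I c * u = slice_embed (inverse u * I * u) c"
  using assms by (simp add: slice_embed_def algebra_simps)

lemma slice_eq_range: "slice I = range (slice_embed I)"
proof -
  have "q \<in> slice I \<longleftrightarrow> q \<in> range (slice_embed I)" for q
    unfolding slice_def using slice_embed_Complex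
    by (smt (verit, ccfv_SIG) complex_surj mem_Collect_eq rangeE rangeI)
  then show ?thesis by blast
qed

text \<open>The point of the closed upper half plane that parametrises the sphere of \<open>q\<close>.\<close>
definition sphere_param :: "quat \<Rightarrow> complex"
  where "sphere_param q = Complex (re q) (norm (qvec q))"

lemma qvec_eq: "qvec q = q - of_real (re q)"
  by (simp add: qvec_def quat_eq_iff)

lemma norm_imag_unit: "I \<in> \<S> \<Longrightarrow> norm I = 1"
  by (simp add: imag_units_iff norm_quat)

lemma qvec_slice_embed: "I \<in> \<S> \<Longrightarrow> qvec (slice_embed I z) = Im z *\<^sub>R I"
  by (simp add: qvec_def slice_embed_def quat_eq_iff imag_units_iff)

lemma re_slice_embed: "I \<in> \<S> \<Longrightarrow> re (slice_embed I z) = Re z"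
  by (simp add: slice_embed_def imag_units_iff)

lemma sphere_param_slice_embed:
  "I \<in> \<S> \<Longrightarrow> 0 \<le> Im z \<Longrightarrow> sphere_param (slice_embed I z) = z"
  by (simp add: sphere_param_def qvec_slice_embed re_slice_embed norm_imag_unit)

lemma Jfun_slice_embed: "I \<in> \<S> \<Longrightarrow> 0 < Im z \<Longrightarrow> Jfun (slice_embed I z) = I"
  by (simp add: Jfun_def qvec_slice_embed norm_imag_unit)

lemma Jfun_imag_unit:
  assumes "qvec q \<noteq> 0" shows "Jfun q \<in> \<S>"
proof -
  have "re (Jfun q) = 0"
    by (simp add: Jfun_def qvec_def)
  moreover have "norm (Jfun q) = 1"
    using assms by (simp add: Jfun_def)
  ultimately show ?thesis
    by (simp add: imag_units_iff norm_quat)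
qed

lemma slice_embed_Jfun_sphere_param:
  "qvec q \<noteq> 0 \<Longrightarrow> slice_embed (Jfun q) (sphere_param q) = q"
  by (simp add: slice_embed_def sphere_param_def Jfun_def)
     (simp add: qvec_def quat_eq_iff)

lemma qvec_eq_0_iff: "qvec q = 0 \<longleftrightarrow> q \<in> \<real>"
proof
  assume "qvec q = 0"
  then have "q = of_real (re q)" by (simp add: qvec_eq)
  then show "q \<in> \<real>" by (metis Reals_of_real)
qed (auto simp: Reals_def qvec_def quat_eq_iff)

lemma Im_sphere_param_pos_iff: "0 < Im (sphere_param q) \<longleftrightarrow> q \<notin> \<real>"
  by (simp add: sphere_param_def qvec_eq_0_iff)

lemma slice_sphere_eq: "slice_sphere q = {slice_embed J (sphere_param q) |J. J \<in> \<S>}"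
  by (simp add: slice_sphere_def sphere_param_def slice_embed_Complex)

lemma continuous_on_re: "continuous_on A re"
proof -
  have "re = (\<lambda>q. q \<bullet> 1)"
    by (auto simp: inner_quat_def)
  moreover have "continuous_on A (\<lambda>q :: quat. q \<bullet> 1)"
    by (intro continuous_intros)
  ultimately show ?thesis by metis
qed

lemma continuous_on_sphere_param: "continuous_on A sphere_param"
proof -
  have "continuous_on A (\<lambda>q. of_real (re q) + \<i> * of_real (norm (q - of_real (re q))))"
    by (intro continuous_intros continuous_on_re)
  moreover have "sphere_param = (\<lambda>q. of_real (re q) + \<i> * of_real (norm (q - of_real (re q))))"
    by (auto simp: sphere_param_def qvec_eq complex_eq_iff)
  ultimately show ?thesis by metis
qed

lemma continuous_on_slice_embed: "continuous_on A (slice_embed I)"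
  unfolding slice_embed_def by (intro continuous_intros)

section \<open>Biquaternions\<close>

text \<open>Quaternions with complex coefficients.  The coefficients commute with everything; they
  stand for the slice preserving functions.\<close>
datatype biquat = Biquat (bq0: complex) (bq1: complex) (bq2: complex) (bq3: complex)

lemma biquat_eq_iff:
  "X = Y \<longleftrightarrow> bq0 X = bq0 Y \<and> bq1 X = bq1 Y \<and> bq2 X = bq2 Y \<and> bq3 X = bq3 Y"
  by (cases X; cases Y) auto

instantiation biquat :: ring_1
begin
definition "0 = Biquat 0 0 0 0"
definition "1 = Biquat 1 0 0 0"
definition "X + Y = Biquat (bq0 X + bq0 Y) (bq1 X + bq1 Y) (bq2 X + bq2 Y) (bq3 X + bq3 Y)"
definition "X - Y = Biquat (bq0 X - bq0 Y) (bq1 X - bq1 Y) (bq2 X - bq2 Y) (bq3 X - bq3 Y)"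
definition "- X = Biquat (- bq0 X) (- bq1 X) (- bq2 X) (- bq3 X)"
definition "X * Y = Biquat
  (bq0 X * bq0 Y - bq1 X * bq1 Y - bq2 X * bq2 Y - bq3 X * bq3 Y)
  (bq0 X * bq1 Y + bq1 X * bq0 Y + bq2 X * bq3 Y - bq3 X * bq2 Y)
  (bq0 X * bq2 Y - bq1 X * bq3 Y + bq2 X * bq0 Y + bq3 X * bq1 Y)
  (bq0 X * bq3 Y + bq1 X * bq2 Y - bq2 X * bq1 Y + bq3 X * bq0 Y)"
instance
  by standard
    (simp_all add: biquat_eq_iff zero_biquat_def one_biquat_def plus_biquat_def
       minus_biquat_def uminus_biquat_def times_biquat_def algebra_simps)
end

lemma biquat_sel [simp]:
  "bq0 0 = 0" "bq1 0 = 0" "bq2 0 = 0" "bq3 0 = 0"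
  "bq0 1 = 1" "bq1 1 = 0" "bq2 1 = 0" "bq3 1 = 0"
  "bq0 (X + Y) = bq0 X + bq0 Y" "bq1 (X + Y) = bq1 X + bq1 Y"
  "bq2 (X + Y) = bq2 X + bq2 Y" "bq3 (X + Y) = bq3 X + bq3 Y"
  "bq0 (X - Y) = bq0 X - bq0 Y" "bq1 (X - Y) = bq1 X - bq1 Y"
  "bq2 (X - Y) = bq2 X - bq2 Y" "bq3 (X - Y) = bq3 X - bq3 Y"
  "bq0 (- X) = - bq0 X" "bq1 (- X) = - bq1 X" "bq2 (- X) = - bq2 X" "bq3 (- X) = - bq3 X"
  "bq0 (X * Y) = bq0 X * bq0 Y - bq1 X * bq1 Y - bq2 X * bq2 Y - bq3 X * bq3 Y"
  "bq1 (X * Y) = bq0 X * bq1 Y + bq1 X * bq0 Y + bq2 X * bq3 Y - bq3 X * bq2 Y"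
  "bq2 (X * Y) = bq0 X * bq2 Y - bq1 X * bq3 Y + bq2 X * bq0 Y + bq3 X * bq1 Y"
  "bq3 (X * Y) = bq0 X * bq3 Y + bq1 X * bq2 Y - bq2 X * bq1 Y + bq3 X * bq0 Y"
  by (simp_all add: zero_biquat_def one_biquat_def plus_biquat_def minus_biquat_def
        uminus_biquat_def times_biquat_def)

definition biscalar :: "complex \<Rightarrow> biquat"
  where "biscalar c = Biquat c 0 0 0"

definition biquat_of :: "quat \<Rightarrow> biquat"
  where "biquat_of q = Biquat (of_real (re q)) (of_real (im1 q)) (of_real (im2 q)) (of_real (im3 q))"

definition biconj :: "biquat \<Rightarrow> biquat"
  where "biconj X = Biquat (bq0 X) (- bq1 X) (- bq2 X) (- bq3 X)"

text \<open>The complexified square of the norm; unlike the latter it has nontrivial zeros.\<close>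
definition binorm :: "biquat \<Rightarrow> complex"
  where "binorm X = (bq0 X)\<^sup>2 + (bq1 X)\<^sup>2 + (bq2 X)\<^sup>2 + (bq3 X)\<^sup>2"

lemma biquat_basic_sel [simp]:
  "bq0 (biscalar c) = c" "bq1 (biscalar c) = 0" "bq2 (biscalar c) = 0" "bq3 (biscalar c) = 0"
  "bq0 (biquat_of q) = of_real (re q)" "bq1 (biquat_of q) = of_real (im1 q)"
  "bq2 (biquat_of q) = of_real (im2 q)" "bq3 (biquat_of q) = of_real (im3 q)"
  "bq0 (biconj X) = bq0 X" "bq1 (biconj X) = - bq1 X"
  "bq2 (biconj X) = - bq2 X" "bq3 (biconj X) = - bq3 X"
  by (simp_all add: biscalar_def biquat_of_def biconj_def)

lemma biscalar_simps [simp]: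
  "biscalar 0 = 0" "biscalar 1 = 1"
  by (simp_all add: biquat_eq_iff)

lemma biscalar_mult: "biscalar (a * b) = biscalar a * biscalar b"
  by (simp add: biquat_eq_iff)

lemma biscalar_commute: "biscalar c * X = X * biscalar c"
  by (simp add: biquat_eq_iff)

lemma biquat_mult_biconj: "X * biconj X = biscalar (binorm X)"
  and biconj_mult_biquat: "biconj X * X = biscalar (binorm X)"
  by (simp_all add: biquat_eq_iff binorm_def power2_eq_square)

lemma binorm_mult: "binorm (X * Y) = binorm X * binorm Y"
  by (simp add: binorm_def power2_eq_square algebra_simps)

text \<open>On the slice of \<open>I\<close> a complex coefficient is read as an element of that slice, written to the
  left of the quaternion units.\<close>
definition slice_eval :: "quat \<Rightarrow> biquat \<Rightarrow> quat"
  where "slice_eval I X =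
    slice_embed I (bq0 X) + slice_embed I (bq1 X) * qi +
    slice_embed I (bq2 X) * qj + slice_embed I (bq3 X) * qk"

lemma slice_eval_add: "slice_eval I (X + Y) = slice_eval I X + slice_eval I Y"
  and slice_eval_diff: "slice_eval I (X - Y) = slice_eval I X - slice_eval I Y"
  and slice_eval_0 [simp]: "slice_eval I 0 = 0"
  and slice_eval_1 [simp]: "slice_eval I 1 = 1"
  and slice_eval_biscalar: "slice_eval I (biscalar c) = slice_embed I c"
  by (simp_all add: slice_eval_def slice_embed_add slice_embed_diff algebra_simps)

lemma slice_eval_biquat_of: "slice_eval I (biquat_of q) = q"
  by (simp add: slice_eval_def slice_embed_of_real quat_eq_iff)

lemma qunit_products:
  "qi * qi = -1" "qj * qj = -1" "qk * qk = -1"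
  "qi * qj = qk" "qj * qk = qi" "qk * qi = qj"
  "qj * qi = - qk" "qk * qj = - qi" "qi * qk = - qj"
  by (simp_all add: quat_eq_iff)

text \<open>On the slice of \<open>I\<close> the coefficients of the right factor must first be moved to the left
  of the left factor; this is where the biquaternion product differs from the pointwise one.\<close>
lemma slice_eval_mult:
  assumes "I \<in> \<S>"
  shows "slice_eval I (X * Y) =
    slice_embed I (bq0 Y) * slice_eval I X + slice_embed I (bq1 Y) * slice_eval I X * qi +
    slice_embed I (bq2 Y) * slice_eval I X * qj + slice_embed I (bq3 Y) * slice_eval I X * qk"
proof -
  note [simp] = slice_embed_mult [OF assms, symmetric]
  have [simp]: "slice_embed I a * (slice_embed I b * q) = slice_embed I (a * b) * q" for a b q
    by (simp flip: mult.assoc)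
  show ?thesis
    unfolding slice_eval_def biquat_sel slice_embed_add slice_embed_diff
    by (simp add: mult.assoc ring_distribs qunit_products slice_embed_mult)
       (simp add: algebra_simps)
qed

lemma slice_eval_conjugate:
  assumes "u \<noteq> 0"
  shows "u * slice_eval (inverse u * I * u) Y =
    slice_embed I (bq0 Y) * u + slice_embed I (bq1 Y) * u * qi +
    slice_embed I (bq2 Y) * u * qj + slice_embed I (bq3 Y) * u * qk"
proof -
  have "u * slice_embed (inverse u * I * u) c = slice_embed I c * u" for c
    using assms by (simp flip: slice_embed_conjugate mult.assoc)
  then have "u * (slice_embed (inverse u * I * u) c * q) = slice_embed I c * (u * q)" for c q
    by (metis mult.assoc)
  with \<open>u * slice_embed (inverse u * I * u) _ = slice_embed I _ * u\<close> show ?thesis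
    unfolding slice_eval_def by (simp add: ring_distribs mult.assoc)
qed

section \<open>Stems of slice functions\<close>

text \<open>If \<open>f (x + I y) = F1 + I * F2\<close> for all imaginary units \<open>I\<close>, then the values for \<open>I = i\<close> and
  \<open>I = - i\<close> already determine \<open>F1\<close> and \<open>F2\<close>: these are the next two functions.\<close>
definition stem_re :: "(quat \<Rightarrow> quat) \<Rightarrow> complex \<Rightarrow> quat"
  where "stem_re f z = (1/2) *\<^sub>R (f (slice_embed qi z) + f (slice_embed (- qi) z))"

definition stem_im :: "(quat \<Rightarrow> quat) \<Rightarrow> complex \<Rightarrow> quat"
  where "stem_im f z = - (1/2) *\<^sub>R (qi * (f (slice_embed qi z) - f (slice_embed (- qi) z)))"

definition stem :: "(quat \<Rightarrow> quat) \<Rightarrow> complex \<Rightarrow> biquat"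
  where "stem f z = Biquat
    (Complex (re (stem_re f z)) (re (stem_im f z)))
    (Complex (im1 (stem_re f z)) (im1 (stem_im f z)))
    (Complex (im2 (stem_re f z)) (im2 (stem_im f z)))
    (Complex (im3 (stem_re f z)) (im3 (stem_im f z)))"

text \<open>The stem describes \<open>f\<close> on the whole sphere with parameter \<open>z\<close>, not only on the slice of \<open>i\<close>.\<close>
definition slice_at :: "(quat \<Rightarrow> quat) \<Rightarrow> complex \<Rightarrow> bool"
  where "slice_at f z \<longleftrightarrow> (\<forall>I\<in>\<S>. f (slice_embed I z) = slice_eval I (stem f z))"

lemma slice_eval_eq_re_im:
  "slice_eval I X =
    Quat (Re (bq0 X)) (Re (bq1 X)) (Re (bq2 X)) (Re (bq3 X)) +
    I * Quat (Im (bq0 X)) (Im (bq1 X)) (Im (bq2 X)) (Im (bq3 X))"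
  by (simp add: slice_eval_def slice_embed_def quat_eq_iff algebra_simps)

lemma stem_eqI:
  assumes "f (slice_embed qi z) = slice_eval qi X" "f (slice_embed (- qi) z) = slice_eval (- qi) X"
  shows "stem f z = X"
  using assms
  by (simp add: stem_def stem_re_def stem_im_def slice_eval_eq_re_im biquat_eq_iff complex_eq_iff)

lemma slice_at_stemI:
  assumes "\<And>I. I \<in> \<S> \<Longrightarrow> f (slice_embed I z) = slice_eval I X"
  shows "slice_at f z" "stem f z = X"
proof -
  show "stem f z = X"
    by (intro stem_eqI assms) (simp_all add: uminus_imag_unit)
  then show "slice_at f z"
    using assms by (simp add: slice_at_def)
qed

lemma slice_atD: "slice_at f z \<Longrightarrow> I \<in> \<S> \<Longrightarrow> f (slice_embed I z) = slice_eval I (stem f z)"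
  by (simp add: slice_at_def)

text \<open>This is the point of the definition of the \<open>*\<close>-product: conjugating the argument by the
  value of the left factor makes it the product of the stems.\<close>
lemma stem_star:
  assumes "slice_at f z" "slice_at g z"
  shows "slice_at (f \<star> g) z" "stem (f \<star> g) z = stem f z * stem g z"
proof -
  have *: "(f \<star> g) (slice_embed I z) = slice_eval I (stem f z * stem g z)" if I: "I \<in> \<S>" for I
  proof (cases "f (slice_embed I z) = 0")
    case True
    then show ?thesis
      using slice_atD [OF assms(1) I] by (simp add: star_def slice_eval_mult [OF I])
  next
    case False
    define u where "u = f (slice_embed I z)"
    have u: "slice_eval I (stem f z) = u" "u \<noteq> 0"
      using slice_atD [OF assms(1) I] False by (simp_all add: u_def)
    have "(f \<star> g) (slice_embed I z) = u * g (slice_embed (inverse u * I * u) z)"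
      using u(2) by (simp add: star_def u_def slice_embed_conjugate)
    also have "\<dots> = u * slice_eval (inverse u * I * u) (stem g z)"
      using slice_atD [OF assms(2) conjugate_imag_unit [OF u(2) I]] by simp
    finally show ?thesis
      using u by (simp add: slice_eval_conjugate slice_eval_mult [OF I])
  qed
  show "slice_at (f \<star> g) z" "stem (f \<star> g) z = stem f z * stem g z"
    by (rule slice_at_stemI; rule *; assumption)+
qed

lemma stem_add:
  assumes "slice_at f z" "slice_at g z"
  shows "slice_at (f + g) z" "stem (f + g) z = stem f z + stem g z"
  using assms slice_at_stemI [of "f + g" z "stem f z + stem g z"]
  by (simp_all add: slice_atD slice_eval_add)

lemma stem_diff:
  assumes "slice_at f z" "slice_at g z"
  shows "slice_at (f - g) z" "stem (f - g) z = stem f z - stem g z"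
  using assms slice_at_stemI [of "f - g" z "stem f z - stem g z"]
  by (simp_all add: slice_atD slice_eval_diff)

lemma stem_cst: "slice_at (cst c) z" "stem (cst c) z = biquat_of c"
  using slice_at_stemI [of "cst c" z "biquat_of c"] by (simp_all add: slice_eval_biquat_of)

lemma stem_0: "slice_at 0 z" "stem 0 z = 0"
  using slice_at_stemI [of 0 z 0] by simp_all

lemma stem_1: "slice_at 1 z" "stem 1 z = 1"
  using slice_at_stemI [of 1 z 1] by simp_all

lemma stem_inverse:
  assumes "slice_at f z" "stem f z = biscalar c"
  shows "slice_at (\<lambda>q. inverse (f q)) z" "stem (\<lambda>q. inverse (f q)) z = biscalar (inverse c)"
  using assms slice_at_stemI [of "\<lambda>q. inverse (f q)" z "biscalar (inverse c)"]
  by (simp_all add: slice_atD slice_eval_biscalar slice_embed_inverse)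

lemma slice_eval_biscalar_mult:
  "I \<in> \<S> \<Longrightarrow> slice_eval I (biscalar c * X) = slice_embed I c * slice_eval I X"
  by (simp add: slice_eval_def slice_embed_mult algebra_simps)

lemma half_quat: "x / 2 = (1/2) *\<^sub>R x" for x :: quat
  by (metis divide_real_def mult_1 of_real_divide of_real_numeral of_real_1 scaleR_conv_of_real
      mult_scaleR_right mult.right_neutral divide_inverse of_real_inverse)

definition biell_plus :: "quat \<Rightarrow> biquat"
  where "biell_plus I = biscalar (1/2) * (1 - biscalar \<i> * biquat_of I)"

definition biell_minus :: "quat \<Rightarrow> biquat"
  where "biell_minus I = biscalar (1/2) * (1 + biscalar \<i> * biquat_of I)"

text \<open>The imaginary unit of the complex coefficients is the stem of \<open>Jfun\<close>.\<close>
lemma stem_ell: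
  assumes "0 < Im z"
  shows "slice_at (ell_plus I) z" "stem (ell_plus I) z = biell_plus I"
    and "slice_at (ell_minus I) z" "stem (ell_minus I) z = biell_minus I"
proof -
  have half: "slice_embed L (1/2) = (1/2) *\<^sub>R 1" for L
    by (simp add: slice_embed_def)
  have *: "ell_plus I (slice_embed L z) = slice_eval L (biell_plus I)"
    "ell_minus I (slice_embed L z) = slice_eval L (biell_minus I)" if "L \<in> \<S>" for L
    using that assms
    by (simp_all add: ell_plus_def ell_minus_def biell_plus_def biell_minus_def Jfun_slice_embed
        slice_eval_biscalar_mult slice_eval_diff slice_eval_add slice_eval_biquat_of half half_quat)
  show "slice_at (ell_plus I) z" "stem (ell_plus I) z = biell_plus I"
    using slice_at_stemI [of "ell_plus I" z "biell_plus I"] * by simp_all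
  show "slice_at (ell_minus I) z" "stem (ell_minus I) z = biell_minus I"
    using slice_at_stemI [of "ell_minus I" z "biell_minus I"] * by simp_all
qed

section \<open>Slice regularity as holomorphy of the stem\<close>

text \<open>The Cauchy-Riemann equation says \<open>D (0, 1) = I * D (1, 0)\<close>; hence the differential along the
  slice is \<open>h \<mapsto> h * d\<close> with \<open>d = D (1, 0)\<close> and \<open>h\<close> read in the slice of \<open>I\<close>.\<close>
lemma SR_iff_slice_derivative:
  "f \<in> SR A \<longleftrightarrow> slice_function A f \<and>
    (\<forall>I\<in>\<S>. \<forall>z. slice_embed I z \<in> A \<longrightarrow>
      (\<exists>d. ((\<lambda>w. f (slice_embed I w)) has_derivative (\<lambda>h. slice_embed I h * d)) (at z)))"
proof -
  have iff: "(\<exists>D. ((\<lambda>(s, t). f (of_real s + I * of_real t)) has_derivative D) (at (x, y)) \<and>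
          (1 / 2) *\<^sub>R (D (1, 0) + I * D (0, 1)) = 0) \<longleftrightarrow>
      (\<exists>d. ((\<lambda>w. f (slice_embed I w)) has_derivative (\<lambda>h. slice_embed I h * d))
        (at (Complex x y)))" (is "?L \<longleftrightarrow> ?R") if I: "I \<in> \<S>" for I x y
  proof
    assume ?L
    then obtain D where D: "((\<lambda>(s, t). f (of_real s + I * of_real t)) has_derivative D) (at (x, y))"
      and CR: "D (1, 0) + I * D (0, 1) = 0" by auto
    interpret D: bounded_linear D using D by (rule has_derivative_bounded_linear)
    have "I * (D (1, 0) + I * D (0, 1)) = 0" using CR by simp
    then have D01: "D (0, 1) = I * D (1, 0)"
      using imag_units_square [OF I] by (simp add: ring_distribs flip: mult.assoc)
    have lin: "D (Re h, Im h) = slice_embed I h * D (1, 0)" for h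
    proof -
      have "D (Re h, Im h) = D (Re h *\<^sub>R (1, 0) + Im h *\<^sub>R (0, 1))" by simp
      also have "\<dots> = Re h *\<^sub>R D (1, 0) + Im h *\<^sub>R D (0, 1)"
        by (simp only: D.add D.scaleR)
      finally show ?thesis by (simp add: D01 slice_embed_def ring_distribs)
    qed
    have "((\<lambda>w. (Re w, Im w)) has_derivative (\<lambda>h. (Re h, Im h))) (at (Complex x y))"
      by (auto intro!: derivative_eq_intros)
    from has_derivative_compose [OF this, of "\<lambda>(s, t). f (of_real s + I * of_real t)" D] D
    have "((\<lambda>w. f (of_real (Re w) + I * of_real (Im w))) has_derivative (\<lambda>h. D (Re h, Im h)))
        (at (Complex x y))" by simp
    then show ?R
      by (metis (no_types, lifting) ext complex_surj lin slice_embed_Complex)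
  next
    assume ?R
    then obtain d where d: "((\<lambda>w. f (slice_embed I w)) has_derivative (\<lambda>h. slice_embed I h * d))
        (at (Complex x y))" by blast
    have eq: "(\<lambda>p. Complex (fst p) (snd p)) = (\<lambda>p. of_real (fst p) + \<i> * of_real (snd p))"
      by (auto simp: complex_eq_iff)
    have "((\<lambda>p. Complex (fst p) (snd p)) has_derivative (\<lambda>p. Complex (fst p) (snd p))) (at (x, y))"
      unfolding eq by (auto intro!: derivative_eq_intros)
    from has_derivative_compose [OF this, of "\<lambda>w. f (slice_embed I w)" "\<lambda>h. slice_embed I h * d"] d
    have "((\<lambda>p. f (slice_embed I (Complex (fst p) (snd p)))) has_derivative
        (\<lambda>p. slice_embed I (Complex (fst p) (snd p)) * d)) (at (x, y))" by simp
    then have "((\<lambda>(s, t). f (of_real s + I * of_real t)) has_derivative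
        (\<lambda>p. slice_embed I (Complex (fst p) (snd p)) * d)) (at (x, y))"
      by (simp add: slice_embed_Complex case_prod_beta')
    moreover have "slice_embed I (Complex 1 0) * d + I * (slice_embed I (Complex 0 1) * d) = 0"
      using imag_units_square [OF I] by (simp add: slice_embed_def flip: mult.assoc)
    ultimately show ?L by (intro exI conjI) (assumption, simp)
  qed
  define P where "P I z \<longleftrightarrow>
    (\<exists>d. ((\<lambda>w. f (slice_embed I w)) has_derivative (\<lambda>h. slice_embed I h * d)) (at z))" for I z
  have slices: "(\<forall>z. slice_embed I z \<in> A \<longrightarrow> P I z) \<longleftrightarrow>
      (\<forall>x y. of_real x + I * of_real y \<in> A \<longrightarrow> P I (Complex x y))" for I
    by (metis complex_surj slice_embed_Complex)
  show ?thesis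
    unfolding SR_def mem_Collect_eq P_def [symmetric] slices
    by (intro arg_cong2 [where f = "(\<and>)"] ball_cong iff_allI imp_cong refl iff [folded P_def])
qed

definition biholo :: "(complex \<Rightarrow> biquat) \<Rightarrow> complex set \<Rightarrow> bool"
  where "biholo A D \<longleftrightarrow> (\<lambda>z. bq0 (A z)) holomorphic_on D \<and> (\<lambda>z. bq1 (A z)) holomorphic_on D \<and>
    (\<lambda>z. bq2 (A z)) holomorphic_on D \<and> (\<lambda>z. bq3 (A z)) holomorphic_on D"

lemma bounded_linear_components:
  "bounded_linear re" "bounded_linear im1" "bounded_linear im2" "bounded_linear im3"
proof -
  have "re = (\<lambda>q. q \<bullet> 1)" "im1 = (\<lambda>q. q \<bullet> qi)" "im2 = (\<lambda>q. q \<bullet> qj)" "im3 = (\<lambda>q. q \<bullet> qk)"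
    by (auto simp: inner_quat_def)
  then show "bounded_linear re" "bounded_linear im1" "bounded_linear im2" "bounded_linear im3"
    using bounded_linear_inner_left by metis+
qed

text \<open>The Cauchy-Riemann equations on the slices of \<open>i\<close> and \<open>- i\<close> together give those of the
  complex function with real part \<open>\<phi> (stem_re f z)\<close> and imaginary part \<open>\<phi> (stem_im f z)\<close>.\<close>
lemma stem_component_differentiable:
  assumes d: "((\<lambda>w. f (slice_embed qi w)) has_derivative (\<lambda>h. slice_embed qi h * d)) (at z)"
    and e: "((\<lambda>w. f (slice_embed (- qi) w)) has_derivative (\<lambda>h. slice_embed (- qi) h * e)) (at z)"
    and \<phi>: "bounded_linear \<phi>"
  shows "(\<lambda>w. Complex (\<phi> (stem_re f w)) (\<phi> (stem_im f w))) field_differentiable (at z)"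
proof -
  interpret \<phi>: bounded_linear \<phi> by fact
  define P Q where "P = (1/2) *\<^sub>R (d + e)" and "Q = (1/2) *\<^sub>R (qi * (d - e))"
  define c where "c = Complex (\<phi> P) (- \<phi> Q)"
  have lin: "(1/2) *\<^sub>R (slice_embed qi h * d + slice_embed (- qi) h * e) = Re h *\<^sub>R P + Im h *\<^sub>R Q"
    "- (1/2) *\<^sub>R (qi * (slice_embed qi h * d - slice_embed (- qi) h * e)) =
      - Re h *\<^sub>R Q + Im h *\<^sub>R P" for h
    by (simp_all add: quat_eq_iff slice_embed_def P_def Q_def algebra_simps)
  have "(stem_re f has_derivative
      (\<lambda>h. (1/2) *\<^sub>R (slice_embed qi h * d + slice_embed (- qi) h * e))) (at z)"
    unfolding stem_re_def [abs_def] by (intro derivative_intros d e)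
  then have re: "(stem_re f has_derivative (\<lambda>h. Re h *\<^sub>R P + Im h *\<^sub>R Q)) (at z)"
    by (simp only: lin)
  have "(stem_im f has_derivative
      (\<lambda>h. - (1/2) *\<^sub>R (qi * (slice_embed qi h * d - slice_embed (- qi) h * e)))) (at z)"
    unfolding stem_im_def [abs_def] by (intro derivative_intros d e)
  then have im: "(stem_im f has_derivative (\<lambda>h. - Re h *\<^sub>R Q + Im h *\<^sub>R P)) (at z)"
    by (simp only: lin)
  have "((\<lambda>w. of_real (\<phi> (stem_re f w)) + \<i> * of_real (\<phi> (stem_im f w))) has_derivative
      (\<lambda>h. of_real (\<phi> (Re h *\<^sub>R P + Im h *\<^sub>R Q)) +
        \<i> * of_real (\<phi> (- Re h *\<^sub>R Q + Im h *\<^sub>R P)))) (at z)"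
    by (intro derivative_intros \<phi>.has_derivative re im)
  moreover have "(\<lambda>w. of_real (\<phi> (stem_re f w)) + \<i> * of_real (\<phi> (stem_im f w))) =
      (\<lambda>w. Complex (\<phi> (stem_re f w)) (\<phi> (stem_im f w)))"
    by (simp add: complex_eq_iff fun_eq_iff)
  moreover have "(\<lambda>h. of_real (\<phi> (Re h *\<^sub>R P + Im h *\<^sub>R Q)) +
      \<i> * of_real (\<phi> (- Re h *\<^sub>R Q + Im h *\<^sub>R P))) = (*) c"
    by (simp add: complex_eq_iff fun_eq_iff c_def \<phi>.add \<phi>.scaleR \<phi>.diff algebra_simps)
  ultimately show ?thesis
    unfolding field_differentiable_def has_field_derivative_def by metis
qed

text \<open>Circular sets are unions of fibres of \<open>sphere_param\<close>; this also covers real points, whose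
  fibres are singletons.\<close>
lemma circular_sphere_param:
  assumes "circular W" "q \<in> W" "sphere_param q' = sphere_param q"
  shows "q' \<in> W"
proof (cases "qvec q' = 0")
  case True
  with assms(3) have "qvec q = 0" "re q = re q'"
    by (simp_all add: sphere_param_def)
  with True have "q' = q" by (simp add: qvec_def quat_eq_iff)
  with assms(2) show ?thesis by simp
next
  case False
  then have "q' \<in> slice_sphere q"
    unfolding slice_sphere_eq assms(3) [symmetric]
    using slice_embed_Jfun_sphere_param [OF False, symmetric] Jfun_imag_unit [OF False] by blast
  with assms(1,2) show ?thesis by (auto simp: circular_def)
qed

lemma slice_embed_in_circular_iff:
  assumes "circular W" "I \<in> \<S>" "0 \<le> Im z"
  shows "slice_embed I z \<in> W \<longleftrightarrow> z \<in> sphere_param ` W"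
  using assms circular_sphere_param sphere_param_slice_embed
  by (metis image_iff)

lemma circular_vimage_sphere_param: "circular (sphere_param -` D)"
proof -
  have "0 \<le> Im (sphere_param q)" for q
    by (simp add: sphere_param_def)
  then show ?thesis
    by (auto simp: circular_def slice_sphere_eq sphere_param_slice_embed)
qed

lemma open_vimage_sphere_param: "open D \<Longrightarrow> open (sphere_param -` D)"
  using continuous_on_sphere_param by (simp add: open_vimage)

lemma open_image_sphere_param:
  assumes "open W" "circular W" "W \<inter> \<real> = {}"
  shows "open (sphere_param ` W)"
proof -
  have "sphere_param ` W = {z. 0 < Im z} \<inter> slice_embed qi -` W"
    using assms slice_embed_in_circular_iff [OF assms(2) qi_imag_unit] Im_sphere_param_pos_iff
    by (auto simp: set_eq_iff) (metis disjoint_iff image_iff less_imp_le)+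
  moreover have "open {z. 0 < Im z}"
    by (rule open_halfspace_Im_gt)
  moreover have "open (slice_embed qi -` W)"
    using assms(1) continuous_on_slice_embed by (simp add: open_vimage)
  ultimately show ?thesis by auto
qed

lemma SR_imp_slice_at:
  assumes "f \<in> SR W" "circular W" "z \<in> sphere_param ` W" "0 \<le> Im z"
  shows "slice_at f z"
proof -
  have mem: "slice_embed I z \<in> W" if "I \<in> \<S>" for I
    using assms that by (simp add: slice_embed_in_circular_iff)
  obtain F1 F2 :: "real \<Rightarrow> real \<Rightarrow> quat" where
    F: "\<And>x y I. I \<in> \<S> \<Longrightarrow> of_real x + I * of_real y \<in> W \<Longrightarrow>
      f (of_real x + I * of_real y) = F1 x y + I * F2 x y"
    using assms(1) by (auto simp: SR_def slice_function_def)
  have f: "f (slice_embed I z) = F1 (Re z) (Im z) + I * F2 (Re z) (Im z)" if "I \<in> \<S>" for I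
    using F [OF that, of "Re z" "Im z"] mem [OF that]
    by (simp flip: slice_embed_Complex)
  define X where "X = Biquat (Complex (re (F1 (Re z) (Im z))) (re (F2 (Re z) (Im z))))
    (Complex (im1 (F1 (Re z) (Im z))) (im1 (F2 (Re z) (Im z))))
    (Complex (im2 (F1 (Re z) (Im z))) (im2 (F2 (Re z) (Im z))))
    (Complex (im3 (F1 (Re z) (Im z))) (im3 (F2 (Re z) (Im z))))"
  show ?thesis
    by (rule slice_at_stemI [where X = X]) (simp add: f slice_eval_eq_re_im X_def)
qed

lemma SR_imp_biholo_stem:
  assumes "f \<in> SR W" "open W" "circular W" "W \<inter> \<real> = {}"
  shows "biholo (stem f) (sphere_param ` W)"
proof -
  have fd: "(\<lambda>w. Complex (\<phi> (stem_re f w)) (\<phi> (stem_im f w))) holomorphic_on sphere_param ` W"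
    if \<phi>: "bounded_linear \<phi>" for \<phi>
    unfolding holomorphic_on_def
  proof
    fix z assume z: "z \<in> sphere_param ` W"
    then have "0 < Im z" using assms(4) Im_sphere_param_pos_iff by auto
    then have "slice_embed qi z \<in> W" "slice_embed (- qi) z \<in> W"
      using z assms(3) by (simp_all add: slice_embed_in_circular_iff uminus_imag_unit)
    then obtain d e where
      "((\<lambda>w. f (slice_embed qi w)) has_derivative (\<lambda>h. slice_embed qi h * d)) (at z)"
      "((\<lambda>w. f (slice_embed (- qi) w)) has_derivative (\<lambda>h. slice_embed (- qi) h * e)) (at z)"
      using assms(1) qi_imag_unit uminus_imag_unit [OF qi_imag_unit]
      unfolding SR_iff_slice_derivative by meson
    from stem_component_differentiable [OF this \<phi>]
    show "(\<lambda>w. Complex (\<phi> (stem_re f w)) (\<phi> (stem_im f w))) field_differentiable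
        at z within sphere_param ` W"
      by (rule field_differentiable_at_within)
  qed
  show ?thesis
    unfolding biholo_def stem_def biquat.sel
    by (intro conjI fd bounded_linear_components)
qed

lemma slice_eval_has_derivative:
  assumes I: "I \<in> \<S>" and A: "biholo A D" "open D" "z \<in> D"
  shows "\<exists>d. ((\<lambda>w. slice_eval I (A w)) has_derivative (\<lambda>h. slice_embed I h * d)) (at z)"
proof -
  have bl: "bounded_linear (slice_embed I)"
    unfolding slice_embed_def
    by (intro bounded_linear_add bounded_linear_scaleR_const bounded_linear_Re bounded_linear_Im)
  have D: "((\<lambda>w. slice_embed I (a w)) has_derivative
      (\<lambda>h. slice_embed I h * slice_embed I (deriv a z))) (at z)"
    if "a holomorphic_on D" for a
  proof -
    have "(a has_field_derivative deriv a z) (at z)"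
      using that A(2,3) by (rule holomorphic_derivI)
    then have "(a has_derivative (\<lambda>h. h * deriv a z)) (at z)"
      by (simp add: has_field_derivative_def mult_commute_abs)
    from bounded_linear.has_derivative [OF bl this] show ?thesis
      by (simp add: slice_embed_mult [OF I])
  qed
  have "((\<lambda>w. slice_eval I (A w)) has_derivative (\<lambda>h.
      slice_embed I h * slice_embed I (deriv (\<lambda>z. bq0 (A z)) z) +
      slice_embed I h * slice_embed I (deriv (\<lambda>z. bq1 (A z)) z) * qi +
      slice_embed I h * slice_embed I (deriv (\<lambda>z. bq2 (A z)) z) * qj +
      slice_embed I h * slice_embed I (deriv (\<lambda>z. bq3 (A z)) z) * qk)) (at z)"
    unfolding slice_eval_def using A(1)
    by (intro derivative_intros D) (simp_all add: biholo_def)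
  then show ?thesis
    by (simp only: mult.assoc flip: distrib_left) blast
qed

text \<open>Conversely a holomorphic stem gives \<open>F1\<close> and \<open>F2\<close> on the upper half plane, and these are
  extended evenly and oddly to the lower one.  A point \<open>x + I y\<close> with \<open>y < 0\<close> is treated as
  \<open>x + (- I) (- y)\<close>.\<close>
lemma biholo_imp_SR:
  assumes A: "biholo A D" "open D" and D: "\<And>z. z \<in> D \<Longrightarrow> 0 < Im z"
    and f: "\<And>I z. I \<in> \<S> \<Longrightarrow> z \<in> D \<Longrightarrow> f (slice_embed I z) = slice_eval I (A z)"
  shows "f \<in> SR (sphere_param -` D)"
  unfolding SR_iff_slice_derivative
proof (intro conjI ballI allI impI)
  define F1 where "F1 x y = (let X = A (Complex x \<bar>y\<bar>) in
    Quat (Re (bq0 X)) (Re (bq1 X)) (Re (bq2 X)) (Re (bq3 X)))" for x y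
  define F2 where "F2 x y = (let X = A (Complex x \<bar>y\<bar>) in
    sgn y *\<^sub>R Quat (Im (bq0 X)) (Im (bq1 X)) (Im (bq2 X)) (Im (bq3 X)))" for x y
  have mem: "Im z \<noteq> 0" "Im z > 0 \<Longrightarrow> z \<in> D" "Im z < 0 \<Longrightarrow> cnj z \<in> D"
    if "I \<in> \<S>" "slice_embed I z \<in> sphere_param -` D" for I z
  proof -
    have m: "sphere_param (slice_embed I z) \<in> D" using that by simp
    show pos: "Im z > 0 \<Longrightarrow> z \<in> D" using m that by (simp add: sphere_param_slice_embed)
    show neg: "cnj z \<in> D" if "Im z < 0"
      using m \<open>I \<in> \<S>\<close> that sphere_param_slice_embed [OF uminus_imag_unit, of I "cnj z"]
      by (simp flip: slice_embed_cnj)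
    show "Im z \<noteq> 0"
      using D [OF m] that(1) by (auto simp: sphere_param_def qvec_slice_embed)
  qed
  have fneg: "f (slice_embed I z) = slice_eval (- I) (A (cnj z))"
    if "I \<in> \<S>" "cnj z \<in> D" for I z
    using f [OF uminus_imag_unit [OF that(1)] that(2)] by (simp flip: slice_embed_cnj)
  have "f (slice_embed I (Complex x y)) = F1 x y + I * F2 x y"
    if I: "I \<in> \<S>" and m: "slice_embed I (Complex x y) \<in> sphere_param -` D" for I x y
  proof (cases "y > 0")
    case True
    with mem [OF that] show ?thesis
      by (simp add: f I slice_eval_eq_re_im F1_def F2_def Let_def)
  next
    case False
    with mem [OF that] have "y < 0" by simp
    moreover from this have "cnj (Complex x y) = Complex x \<bar>y\<bar>" by (simp add: complex_eq_iff)
    ultimately show ?thesis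
      using mem(3) [OF that] fneg [OF I, of "Complex x y"]
      by (simp add: slice_eval_eq_re_im F1_def F2_def Let_def)
  qed
  moreover have "F1 x (- y) = F1 x y" "F2 x (- y) = - F2 x y" for x y
    by (simp_all add: F1_def F2_def Let_def sgn_minus)
  ultimately show "slice_function (sphere_param -` D) f"
    unfolding slice_function_def
    by (intro exI [of _ F1] exI [of _ F2]) (simp flip: slice_embed_Complex)
  fix I z assume I: "I \<in> \<S>" and z: "slice_embed I z \<in> sphere_param -` D"
  show "\<exists>d. ((\<lambda>w. f (slice_embed I w)) has_derivative (\<lambda>h. slice_embed I h * d)) (at z)"
  proof (cases "Im z > 0")
    case True
    with mem [OF I z] have "z \<in> D" by blast
    then obtain d where
      "((\<lambda>w. slice_eval I (A w)) has_derivative (\<lambda>h. slice_embed I h * d)) (at z)"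
      using slice_eval_has_derivative I A by blast
    then have "((\<lambda>w. f (slice_embed I w)) has_derivative (\<lambda>h. slice_embed I h * d)) (at z)"
      by (rule has_derivative_transform_within_open [OF _ A(2) \<open>z \<in> D\<close>]) (simp add: f I)
    then show ?thesis ..
  next
    case False
    with mem [OF I z] have c: "cnj z \<in> D" by auto
    then obtain d where
      d: "((\<lambda>w. slice_eval (- I) (A w)) has_derivative (\<lambda>h. slice_embed (- I) h * d)) (at (cnj z))"
      using slice_eval_has_derivative uminus_imag_unit [OF I] A by blast
    have "(cnj has_derivative cnj) (at z)"
      by (intro bounded_linear_imp_has_derivative bounded_linear_cnj)
    from has_derivative_compose [OF this d]
    have "((\<lambda>w. slice_eval (- I) (A (cnj w))) has_derivative (\<lambda>h. slice_embed I h * d)) (at z)"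
      by (simp flip: slice_embed_cnj)
    moreover have "open (cnj -` D)"
      using A(2) by (intro open_vimage continuous_intros)
    ultimately have "((\<lambda>w. f (slice_embed I w)) has_derivative (\<lambda>h. slice_embed I h * d)) (at z)"
      by (rule has_derivative_transform_within_open) (use c in \<open>auto simp: fneg I\<close>)
    then show ?thesis ..
  qed
qed

section \<open>Semi-regularity as meromorphy of the stem\<close>

definition bimero :: "(complex \<Rightarrow> biquat) \<Rightarrow> complex set \<Rightarrow> bool"
  where "bimero A D \<longleftrightarrow> (\<lambda>z. bq0 (A z)) meromorphic_on D \<and> (\<lambda>z. bq1 (A z)) meromorphic_on D \<and>
    (\<lambda>z. bq2 (A z)) meromorphic_on D \<and> (\<lambda>z. bq3 (A z)) meromorphic_on D"

abbreviation params :: "quat set \<Rightarrow> complex set"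
  where "params \<Omega> \<equiv> sphere_param ` \<Omega>"

lemma product_domain_params:
  assumes "product_domain \<Omega>"
  shows "open (params \<Omega>)" "connected (params \<Omega>)" "params \<Omega> \<noteq> {}"
    "\<And>z. z \<in> params \<Omega> \<Longrightarrow> 0 < Im z"
    "\<And>q. sphere_param q \<in> params \<Omega> \<longleftrightarrow> q \<in> \<Omega>"
proof -
  have \<Omega>: "open \<Omega>" "connected \<Omega>" "\<Omega> \<noteq> {}" "circular \<Omega>" "\<Omega> \<inter> \<real> = {}"
    using assms by (auto simp: product_domain_def circular_domain_def)
  show "open (params \<Omega>)" using \<Omega> by (intro open_image_sphere_param)
  show "connected (params \<Omega>)"
    using continuous_on_sphere_param \<Omega>(2) by (rule connected_continuous_image)
  show "params \<Omega> \<noteq> {}" using \<Omega> by simp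
  show "0 < Im z" if "z \<in> params \<Omega>" for z
    using that \<Omega>(5) Im_sphere_param_pos_iff by auto
  show "sphere_param q \<in> params \<Omega> \<longleftrightarrow> q \<in> \<Omega>" for q
    using \<Omega>(4) circular_sphere_param by auto
qed

text \<open>The second factor has no zeros in the upper half plane.  Therefore a power of \<open>qDelta p\<close> changes
  the order of a stem at the parameter of \<open>p\<close> like a power of the first factor.\<close>
lemma qDelta_slice_embed:
  assumes "I \<in> \<S>"
  shows "qDelta p (slice_embed I z) =
    slice_embed I ((z - sphere_param p) * (z - cnj (sphere_param p)))"
proof -
  have "(norm p)\<^sup>2 = (re p)\<^sup>2 + (norm (qvec p))\<^sup>2"
    by (simp add: norm_quat qvec_def)
  then have "(z - sphere_param p) * (z - cnj (sphere_param p)) =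
      z * z - of_real (2 * re p) * z + of_real ((norm p)\<^sup>2)"
    by (simp add: complex_eq_iff sphere_param_def algebra_simps power2_eq_square)
  then show ?thesis
    unfolding qDelta_def
    by (simp only: slice_embed_add slice_embed_diff slice_embed_mult [OF assms]
        slice_embed_of_real power2_eq_square)
qed

lemma sphere_param_slice_sphere: "q \<in> slice_sphere p \<longleftrightarrow> sphere_param q = sphere_param p"
proof
  assume eq: "sphere_param q = sphere_param p"
  show "q \<in> slice_sphere p"
  proof (cases "qvec q = 0")
    case True
    then have "q = slice_embed qi (sphere_param q)"
      by (simp add: sphere_param_def slice_embed_def) (simp add: qvec_def quat_eq_iff)
    then show ?thesis
      unfolding slice_sphere_eq eq using qi_imag_unit by blast
  next
    case False
    then show ?thesis
      unfolding slice_sphere_eq eq [symmetric]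
      using slice_embed_Jfun_sphere_param [OF False, symmetric] Jfun_imag_unit [OF False] by blast
  qed
next
  have "0 \<le> Im (sphere_param p)"
    by (simp add: sphere_param_def)
  then show "sphere_param q = sphere_param p" if "q \<in> slice_sphere p"
    using that by (auto simp: slice_sphere_eq sphere_param_slice_embed)
qed

lemma SR_imp_stem:
  assumes "f \<in> SR W" "open W" "circular W" "W \<inter> \<real> = {}"
  shows "biholo (stem f) (params W)" "\<And>z. z \<in> params W \<Longrightarrow> slice_at f z"
  using assms SR_imp_biholo_stem SR_imp_slice_at Im_sphere_param_pos_iff
  by (blast, metis (no_types, lifting) disjoint_iff image_iff less_imp_le)

text \<open>Near an exceptional sphere the stem is the quotient of a holomorphic stem by a power of
  \<open>(z - z0) * (z - cnj z0)\<close>.  Since such spheres are isolated, the parameters of the domain of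
  regularity are cosparse.\<close>
lemma semi_regular_imp_bimero:
  assumes \<Omega>: "product_domain \<Omega>" and f: "semi_regular_with \<Omega> W f"
  shows "bimero (stem f) (params \<Omega>)"
    and "\<forall>\<^sub>\<approx>z\<in>params \<Omega>. z \<in> params W"
    and "\<And>z. z \<in> params W \<Longrightarrow> slice_at f z"
proof -
  note D = product_domain_params [OF \<Omega>]
  have W: "W \<subseteq> \<Omega>" "open W" "circular W" "f \<in> SR W"
    and poles: "\<And>p. p \<in> \<Omega> - W \<Longrightarrow> pole_or_removable \<Omega> W f p"
    using f by (auto simp: semi_regular_with_def)
  have real: "\<Omega> \<inter> \<real> = {}" using \<Omega> by (simp add: product_domain_def)
  then have real_W: "W \<inter> \<real> = {}" using W(1) by blast
  note W' = SR_imp_stem [OF W(4,2,3) real_W]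
  show "slice_at f z" if "z \<in> params W" for z by (rule W'(2)) fact
  have open_W: "open (params W)"
    using W real_W by (intro open_image_sphere_param)
  have "(\<forall>\<^sub>F z in at z0. z \<in> params W) \<and> bimero (stem f) {z0}" if z0: "z0 \<in> params \<Omega>" for z0
  proof (cases "z0 \<in> params W")
    case True
    have "g meromorphic_on {z0}" if "g holomorphic_on params W" for g
      using that open_W True analytic_at analytic_on_imp_meromorphic_on by blast
    with W'(1) have "bimero (stem f) {z0}"
      by (simp add: bimero_def biholo_def)
    with True open_W show ?thesis
      by (simp add: eventually_at_in_open')
  next
    case False
    from z0 obtain p where p: "p \<in> \<Omega>" "z0 = sphere_param p" by blast
    with False have "p \<in> \<Omega> - W" by blast
    then obtain U m g where U: "open U" "circular U" "slice_sphere p \<subseteq> U" "U \<subseteq> \<Omega>"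
      "U - slice_sphere p \<subseteq> W" and g: "g \<in> SR U"
      "\<And>q. q \<in> U - slice_sphere p \<Longrightarrow> g q = (qDelta p q) ^ m * f q"
      using poles unfolding pole_or_removable_def by metis
    have real_U: "U \<inter> \<real> = {}" using U(4) real by blast
    note U' = SR_imp_stem [OF g(1) U(1,2) real_U]
    have open_U: "open (params U)"
      using U real_U by (intro open_image_sphere_param)
    have "p \<in> slice_sphere p" by (simp add: sphere_param_slice_sphere)
    with U(3) p have z0U: "z0 \<in> params U" by blast
    have UW: "z \<in> params W" if "z \<in> params U" "z \<noteq> z0" for z
      using that U(5) p(2) sphere_param_slice_sphere by blast
    have ev: "\<forall>\<^sub>F z in at z0. z \<in> params U \<and> z \<noteq> z0"
      using z0U open_U by (simp add: eventually_at_in_open' eventually_conj eventually_at_filter)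
         (auto intro: eventually_nhds_in_open eventually_mono)
    define \<delta> where "\<delta> z = ((z - z0) * (z - cnj z0)) ^ m" for z
    have \<delta>0: "\<delta> z \<noteq> 0" if "z \<in> params U" "z \<noteq> z0" for z
    proof -
      have "0 < Im z" "0 < Im z0" using that z0 U(4) D(4) by blast+
      then have "z \<noteq> cnj z0" by (auto simp: complex_eq_iff)
      with that show ?thesis by (simp add: \<delta>_def)
    qed
    have stem_g: "stem g z = biscalar (\<delta> z) * stem f z" if z: "z \<in> params U" "z \<noteq> z0" for z
    proof (rule slice_at_stemI(2))
      fix I assume I: "I \<in> \<S>"
      have Im: "0 < Im z" using z(1) U(4) D(4) by blast
      have "slice_embed I z \<in> U" "sphere_param (slice_embed I z) = z"
        using I U(2) z(1) Im by (simp_all add: slice_embed_in_circular_iff sphere_param_slice_embed)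
      with z(2) p(2) have "slice_embed I z \<in> U - slice_sphere p"
        by (simp add: sphere_param_slice_sphere)
      from g(2) [OF this] show "g (slice_embed I z) = slice_eval I (biscalar (\<delta> z) * stem f z)"
        using slice_atD [OF W'(2) [OF UW [OF z]] I]
        by (simp add: qDelta_slice_embed [OF I] slice_eval_biscalar_mult [OF I] \<delta>_def p(2)
            slice_embed_power [OF I] slice_embed_mult [OF I])
    qed
    have mero: "(\<lambda>z. b (stem f z)) meromorphic_on {z0}"
      if b: "\<And>c X. b (biscalar c * X) = c * b X" and g: "(\<lambda>z. b (stem g z)) holomorphic_on params U"
      for b :: "biquat \<Rightarrow> complex"
    proof -
      have "(\<lambda>z. b (stem g z) / \<delta> z) meromorphic_on {z0}"
        unfolding \<delta>_def using g open_U z0U analytic_at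
        by (intro meromorphic_intros analytic_on_imp_meromorphic_on) blast
      moreover have "\<forall>\<^sub>F z in at z0. b (stem g z) / \<delta> z = b (stem f z)"
        using ev by eventually_elim (simp add: stem_g b \<delta>0)
      ultimately show ?thesis
        using meromorphic_on_cong [of "{z0}" "\<lambda>z. b (stem g z) / \<delta> z" "\<lambda>z. b (stem f z)", OF _ refl]
        by simp
    qed
    have "bimero (stem f) {z0}"
      unfolding bimero_def using U'(1) by (intro conjI mero) (simp_all add: biholo_def)
    moreover have "\<forall>\<^sub>F z in at z0. z \<in> params W"
      using ev by eventually_elim (use UW in blast)
    ultimately show ?thesis by blast
  qed
  then have *: "\<And>z. z \<in> params \<Omega> \<Longrightarrow> bimero (stem f) {z}"
    "\<And>z. z \<in> params \<Omega> \<Longrightarrow> \<forall>\<^sub>F z in at z. z \<in> params W" by blast+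
  from *(1) show "bimero (stem f) (params \<Omega>)"
    by (simp add: bimero_def meromorphic_on_meromorphic_at [of _ "params \<Omega>"])
  from *(2) D(1) show "\<forall>\<^sub>\<approx>z\<in>params \<Omega>. z \<in> params W"
    by (simp add: eventually_cosparse_open_eq)
qed

text \<open>All large exponents are allowed, so that one exponent can serve all four components of a stem.\<close>
lemma meromorphic_pole_cleared:
  assumes "f meromorphic_on {z0}"
  shows "\<exists>m0::nat. \<forall>m\<ge>m0. \<exists>h. h analytic_on {z0} \<and> (\<forall>\<^sub>F z in at z0. h z = (z - z0) ^ m * f z)"
proof -
  from assms obtain F where F: "(\<lambda>w. f (z0 + w)) has_laurent_expansion F"
    by (auto simp: meromorphic_on_def)
  have "\<exists>h. h analytic_on {z0} \<and> (\<forall>\<^sub>F z in at z0. h z = (z - z0) ^ m * f z)"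
    if m: "nat (- fls_subdegree F) \<le> m" for m
  proof -
    let ?k = "\<lambda>z. (z - z0) ^ m * f z"
    have mero: "?k meromorphic_on {z0}"
      by (intro meromorphic_intros assms)
    have "(\<lambda>w. w ^ m * f (z0 + w)) has_laurent_expansion fls_X_intpow m * F"
      by (intro laurent_expansion_intros F)
    then have k: "(\<lambda>w. ?k (z0 + w)) has_laurent_expansion fls_X_intpow m * F"
      by simp
    have "\<not> fls_subdegree (fls_X_intpow (int m) * F) < 0"
    proof (cases "F = 0")
      case False
      then show ?thesis using m by (simp add: fls_subdegree_mult)
    qed simp
    then have "\<not> is_pole ?k z0"
      using has_laurent_expansion_imp_is_pole_iff [OF k] by blast
    moreover have iso: "isolated_singularity_at ?k z0"
      using mero by (meson insertI1 meromorphic_on_isolated_singularity)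
    ultimately have "remove_sings ?k analytic_on {z0}"
      using remove_sings_nicely_meromorphic [OF mero] nicely_meromorphic_on_imp_analytic_at
      by (metis insertI1 is_pole_remove_sings_iff)
    with eventually_remove_sings_eq_at [OF iso] show ?thesis by blast
  qed
  then show ?thesis by blast
qed

text \<open>The radius is only required to be small, so that it can be shrunk further.\<close>
lemma bimero_pole_cleared:
  assumes "bimero A {z0}"
  shows "\<exists>m H. \<forall>\<^sub>F r in at_right 0. biholo H (ball z0 r) \<and>
    (\<forall>z\<in>ball z0 r - {z0}. H z = biscalar ((z - z0) ^ m) * A z)"
proof -
  obtain m0 where m0: "\<And>m. m \<ge> m0 \<Longrightarrow>
      \<exists>h. h analytic_on {z0} \<and> (\<forall>\<^sub>F z in at z0. h z = (z - z0) ^ m * bq0 (A z))"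
    using assms meromorphic_pole_cleared [of "\<lambda>z. bq0 (A z)" z0] unfolding bimero_def by blast
  obtain m1 where m1: "\<And>m. m \<ge> m1 \<Longrightarrow>
      \<exists>h. h analytic_on {z0} \<and> (\<forall>\<^sub>F z in at z0. h z = (z - z0) ^ m * bq1 (A z))"
    using assms meromorphic_pole_cleared [of "\<lambda>z. bq1 (A z)" z0] unfolding bimero_def by blast
  obtain m2 where m2: "\<And>m. m \<ge> m2 \<Longrightarrow>
      \<exists>h. h analytic_on {z0} \<and> (\<forall>\<^sub>F z in at z0. h z = (z - z0) ^ m * bq2 (A z))"
    using assms meromorphic_pole_cleared [of "\<lambda>z. bq2 (A z)" z0] unfolding bimero_def by blast
  obtain m3 where m3: "\<And>m. m \<ge> m3 \<Longrightarrow>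
      \<exists>h. h analytic_on {z0} \<and> (\<forall>\<^sub>F z in at z0. h z = (z - z0) ^ m * bq3 (A z))"
    using assms meromorphic_pole_cleared [of "\<lambda>z. bq3 (A z)" z0] unfolding bimero_def by blast
  define m where "m = m0 + m1 + m2 + m3"
  obtain h0 where h0: "h0 analytic_on {z0}"
    "\<forall>\<^sub>F z in at z0. h0 z = (z - z0) ^ m * bq0 (A z)"
    using m0 [of m] by (auto simp: m_def)
  obtain h1 where h1: "h1 analytic_on {z0}"
    "\<forall>\<^sub>F z in at z0. h1 z = (z - z0) ^ m * bq1 (A z)"
    using m1 [of m] by (auto simp: m_def)
  obtain h2 where h2: "h2 analytic_on {z0}"
    "\<forall>\<^sub>F z in at z0. h2 z = (z - z0) ^ m * bq2 (A z)"
    using m2 [of m] by (auto simp: m_def)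
  obtain h3 where h3: "h3 analytic_on {z0}"
    "\<forall>\<^sub>F z in at z0. h3 z = (z - z0) ^ m * bq3 (A z)"
    using m3 [of m] by (auto simp: m_def)
  define H where "H z = Biquat (h0 z) (h1 z) (h2 z) (h3 z)" for z
  have small: "\<forall>\<^sub>F r in at_right 0. \<forall>z\<in>ball z0 r - {z0}. P z" if P: "\<forall>\<^sub>F z in at z0. P z" for P
  proof -
    from P obtain d where "d > 0" "\<And>z. z \<noteq> z0 \<Longrightarrow> dist z z0 < d \<Longrightarrow> P z"
      by (auto simp: eventually_at)
    then have "\<forall>z\<in>ball z0 r - {z0}. P z" if "r < d" for r
      using that by (simp add: dist_commute)
    with \<open>d > 0\<close> show ?thesis
      by (auto simp: eventually_at_right)
  qed
  have holo: "\<forall>\<^sub>F r in at_right 0. h holomorphic_on ball z0 r" if a: "h analytic_on {z0}" for h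
  proof -
    from a obtain d where "d > 0" "h holomorphic_on ball z0 d"
      by (auto simp: analytic_on_def)
    then show ?thesis
      by (auto simp: eventually_at_right intro!: exI [of _ d] elim!: holomorphic_on_subset)
  qed
  have "\<forall>\<^sub>F z in at z0. H z = biscalar ((z - z0) ^ m) * A z"
    using h0(2) h1(2) h2(2) h3(2) by eventually_elim (simp add: H_def biquat_eq_iff)
  from small [OF this] have "\<forall>\<^sub>F r in at_right 0. biholo H (ball z0 r) \<and>
      (\<forall>z\<in>ball z0 r - {z0}. H z = biscalar ((z - z0) ^ m) * A z)"
    using holo [OF h0(1)] holo [OF h1(1)] holo [OF h2(1)] holo [OF h3(1)]
    by eventually_elim (simp add: biholo_def H_def)
  then show ?thesis by blast
qed

text \<open>The slice function with stem \<open>A\<close>.\<close>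
definition biquat_lift :: "(complex \<Rightarrow> biquat) \<Rightarrow> quat \<Rightarrow> quat"
  where "biquat_lift A q = slice_eval (Jfun q) (A (sphere_param q))"

lemma biquat_lift_slice_embed:
  "I \<in> \<S> \<Longrightarrow> 0 < Im z \<Longrightarrow> biquat_lift A (slice_embed I z) = slice_eval I (A z)"
  by (simp add: biquat_lift_def Jfun_slice_embed sphere_param_slice_embed)

lemma stem_biquat_lift:
  assumes "0 < Im z"
  shows "slice_at (biquat_lift A) z" "stem (biquat_lift A) z = A z"
  using slice_at_stemI [of "biquat_lift A" z "A z"] assms
  by (simp_all add: biquat_lift_slice_embed)

text \<open>The domain of regularity consists of the spheres on which the stem is analytic and describes
  \<open>f\<close>.  Any further generic property \<open>P\<close> can be imposed by removing more spheres, which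
  then are removable singularities; with it, agreement of two functions and slice preservation
  are arranged on the whole domain.\<close>
lemma bimero_imp_semi_regular:
  assumes \<Omega>: "product_domain \<Omega>" and f: "bimero (stem f) (params \<Omega>)"
    "\<forall>\<^sub>\<approx>z\<in>params \<Omega>. slice_at f z" and P: "\<forall>\<^sub>\<approx>z\<in>params \<Omega>. P z"
  shows "\<exists>W. semi_regular_with \<Omega> W f \<and> (\<forall>z\<in>params W. P z)"
proof -
  note D = product_domain_params [OF \<Omega>]
  have analytic: "\<forall>\<^sub>\<approx>z\<in>params \<Omega>. (\<lambda>z. bq0 (stem f z)) analytic_on {z} \<and>
    (\<lambda>z. bq1 (stem f z)) analytic_on {z} \<and> (\<lambda>z. bq2 (stem f z)) analytic_on {z} \<and>
    (\<lambda>z. bq3 (stem f z)) analytic_on {z}"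
    using f(1) unfolding bimero_def
    by (intro eventually_conj meromorphic_on_imp_analytic_cosparse) auto
  \<comment> \<open>the exceptional parameters: everything that can fail at a point\<close>
  define S where "S = {z. \<not> (slice_at f z \<and> P z \<and> (\<lambda>z. bq0 (stem f z)) analytic_on {z} \<and>
    (\<lambda>z. bq1 (stem f z)) analytic_on {z} \<and> (\<lambda>z. bq2 (stem f z)) analytic_on {z} \<and>
    (\<lambda>z. bq3 (stem f z)) analytic_on {z})}"
  have S: "S sparse_in params \<Omega>"
    unfolding S_def eventually_cosparse [symmetric] using f(2) P analytic
    by (intro eventually_conj) (auto elim: eventually_mono)
  define G where "G = params \<Omega> - S"
  have G: "open G" unfolding G_def by (rule open_diff_sparse_pts [OF D(1) S])
  have G_pos: "0 < Im z" if "z \<in> G" for z using that D(4) by (auto simp: G_def)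
  define W where "W = sphere_param -` G"
  have W: "W \<subseteq> \<Omega>" "open W" "circular W"
    using G D(5) by (auto simp: W_def open_vimage_sphere_param circular_vimage_sphere_param G_def)
  have holo: "g holomorphic_on G" if "\<And>z. z \<in> G \<Longrightarrow> g analytic_on {z}" for g
    using that analytic_on_analytic_at analytic_imp_holomorphic by metis
  have "biholo (stem f) G"
    unfolding biholo_def by (intro conjI holo) (simp_all add: G_def S_def)
  then have fW: "f \<in> SR W"
    unfolding W_def by (rule biholo_imp_SR [OF _ G G_pos]) (auto simp: slice_atD G_def S_def)
  have "pole_or_removable \<Omega> W f p" if p: "p \<in> \<Omega> - W" for p
  proof -
    define z0 where "z0 = sphere_param p"
    have z0: "z0 \<in> params \<Omega>" "0 < Im z0" using p D(4) by (auto simp: z0_def)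
    have "bimero (stem f) {z0}"
      using f(1) z0 unfolding bimero_def by (auto intro: meromorphic_on_subset)
    then obtain m H where H: "\<forall>\<^sub>F r in at_right 0. biholo H (ball z0 r) \<and>
        (\<forall>z\<in>ball z0 r - {z0}. H z = biscalar ((z - z0) ^ m) * stem f z)"
      using bimero_pole_cleared by blast
    have "\<forall>\<^sub>F z in at z0. z \<in> params \<Omega> \<and> z \<notin> S"
      using D(1) S z0(1) by (intro eventually_conj eventually_at_in_open')
        (auto simp: sparse_in_eventually_iff)
    then obtain d where "d > 0" "\<And>z. z \<noteq> z0 \<Longrightarrow> dist z z0 < d \<Longrightarrow> z \<in> G"
      by (auto simp: eventually_at G_def)
    then have "\<forall>\<^sub>F r in at_right 0. ball z0 r - {z0} \<subseteq> G"
      by (auto simp: eventually_at_right dist_commute subset_iff intro!: exI [of _ d])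
    with H eventually_at_right_less [of "0::real"]
    have "\<forall>\<^sub>F r in at_right 0. 0 < r \<and> ball z0 r - {z0} \<subseteq> G \<and> biholo H (ball z0 r) \<and>
        (\<forall>z\<in>ball z0 r - {z0}. H z = biscalar ((z - z0) ^ m) * stem f z)"
      by eventually_elim simp
    then obtain r where r: "0 < r" "ball z0 r - {z0} \<subseteq> G" "biholo H (ball z0 r)"
      "\<And>z. z \<in> ball z0 r - {z0} \<Longrightarrow> H z = biscalar ((z - z0) ^ m) * stem f z"
      using eventually_happens'[of "at_right (0::real)"] trivial_limit_at_right_real by blast
    have ball: "z \<in> params \<Omega> \<and> 0 < Im z" if "z \<in> ball z0 r" for z
      using that r(2) z0 G_pos by (cases "z = z0") (auto simp: G_def)
    define U where "U = sphere_param -` ball z0 r"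
    \<comment> \<open>\<open>H\<close> clears the pole with powers of \<open>z - z0\<close>; \<open>qDelta p\<close> also brings in \<open>z - cnj z0\<close>\<close>
    define K where "K z = biscalar ((z - cnj z0) ^ m) * H z" for z
    have "biholo K (ball z0 r)"
      using r(3) by (auto simp: biholo_def K_def intro!: holomorphic_intros)
    then have "biquat_lift K \<in> SR U"
      unfolding U_def using ball by (intro biholo_imp_SR) (auto simp: biquat_lift_slice_embed)
    moreover have "biquat_lift K q = (qDelta p q) ^ m * f q" if q: "q \<in> U - slice_sphere p" for q
    proof -
      define z where "z = sphere_param q"
      have z: "z \<in> ball z0 r - {z0}"
        using q by (auto simp: U_def z_def z0_def sphere_param_slice_sphere)
      then have zG: "z \<in> G" using r(2) by blast
      then have nz: "qvec q \<noteq> 0" using G_pos [OF zG] by (simp add: z_def sphere_param_def)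
      define I where "I = Jfun q"
      have I: "I \<in> \<S>" "slice_embed I z = q"
        using nz by (simp_all add: I_def z_def Jfun_imag_unit slice_embed_Jfun_sphere_param)
      have "f q = slice_eval I (stem f z)"
        using zG I slice_atD by (force simp: G_def S_def)
      moreover have "biquat_lift K q = slice_eval I (K z)"
        by (simp add: biquat_lift_def I_def z_def)
      moreover have "K z = biscalar (((z - z0) * (z - cnj z0)) ^ m) * stem f z"
        unfolding K_def r(4) [OF z] mult.assoc [symmetric] biscalar_mult [symmetric]
          power_mult_distrib [symmetric]
        by (simp add: mult.commute)
      moreover have "(qDelta p q) ^ m = slice_embed I (((z - z0) * (z - cnj z0)) ^ m)"
        using qDelta_slice_embed [OF I(1), of p z]
        by (simp only: I(2) z0_def slice_embed_power [OF I(1)])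
      ultimately show ?thesis
        using I(1) by (simp add: slice_eval_biscalar_mult)
    qed
    moreover have "open U" "circular U"
      by (simp_all add: U_def open_vimage_sphere_param circular_vimage_sphere_param)
    moreover have "slice_sphere p \<subseteq> U"
      using r(1) by (auto simp: U_def sphere_param_slice_sphere z0_def)
    moreover have "U \<subseteq> \<Omega>"
      using ball D(5) unfolding U_def by blast
    moreover have "U - slice_sphere p \<subseteq> W"
      using r(2) by (auto simp: U_def W_def sphere_param_slice_sphere z0_def)
    ultimately show ?thesis
      unfolding pole_or_removable_def by blast
  qed
  with W fW have "semi_regular_with \<Omega> W f"
    by (simp add: semi_regular_with_def)
  moreover have "\<forall>z\<in>params W. P z"
    by (auto simp: W_def G_def S_def)
  ultimately show ?thesis by blast
qed

section \<open>Calculus of stems\<close>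

lemma bimero_intros:
  "bimero A D \<Longrightarrow> bimero B D \<Longrightarrow> bimero (\<lambda>z. A z + B z) D"
  "bimero A D \<Longrightarrow> bimero B D \<Longrightarrow> bimero (\<lambda>z. A z - B z) D"
  "bimero A D \<Longrightarrow> bimero B D \<Longrightarrow> bimero (\<lambda>z. A z * B z) D"
  "bimero A D \<Longrightarrow> bimero (\<lambda>z. biconj (A z)) D"
  "k meromorphic_on D \<Longrightarrow> bimero (\<lambda>z. biscalar (k z)) D"
  "bimero (\<lambda>z. X) D"
  unfolding bimero_def biquat_sel biquat_basic_sel by (auto intro!: meromorphic_intros)

lemma bimero_component:
  assumes "bimero A D"
  shows "(\<lambda>z. bq0 (A z)) meromorphic_on D" "(\<lambda>z. bq1 (A z)) meromorphic_on D"
    "(\<lambda>z. bq2 (A z)) meromorphic_on D" "(\<lambda>z. bq3 (A z)) meromorphic_on D"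
    "(\<lambda>z. binorm (A z)) meromorphic_on D"
  using assms by (auto simp: bimero_def binorm_def intro!: meromorphic_intros)

lemma bimero_cong:
  assumes "bimero A D" "\<forall>\<^sub>\<approx>z\<in>D. A z = B z"
  shows "bimero B D"
proof -
  have "(\<lambda>z. b (B z)) meromorphic_on D" if "(\<lambda>z. b (A z)) meromorphic_on D"
    for b :: "biquat \<Rightarrow> complex"
  proof -
    have "\<forall>\<^sub>\<approx>z\<in>D. b (A z) = b (B z)"
      using assms(2) by eventually_elim simp
    from meromorphic_on_cong' [OF this refl] that show ?thesis by simp
  qed
  with assms(1) show ?thesis by (simp add: bimero_def)
qed

definition biinverse :: "biquat \<Rightarrow> biquat"
  where "biinverse X = biscalar (inverse (binorm X)) * biconj X"

lemma biinverse:
  assumes "binorm X \<noteq> 0"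
  shows "X * biinverse X = 1" "biinverse X * X = 1"
proof -
  have "X * biinverse X = biscalar (inverse (binorm X)) * (X * biconj X)"
    unfolding biinverse_def mult.assoc [symmetric] biscalar_commute [of _ X] ..
  with assms show "X * biinverse X = 1"
    by (simp add: biquat_mult_biconj flip: biscalar_mult)
  show "biinverse X * X = 1"
    using assms by (simp add: biinverse_def mult.assoc biconj_mult_biquat flip: biscalar_mult)
qed

text \<open>The slices of \<open>i\<close> and \<open>- i\<close> force the components at \<open>j\<close> and \<open>k\<close> to vanish, those of \<open>j\<close> and
  \<open>- j\<close> the component at \<open>i\<close>.\<close>
lemma slice_eval_preserves_slices_iff:
  "(\<forall>I\<in>\<S>. slice_eval I X \<in> slice I) \<longleftrightarrow> X = biscalar (bq0 X)"
proof
  assume *: "\<forall>I\<in>\<S>. slice_eval I X \<in> slice I"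
  have "slice_eval qi X \<in> slice qi" "slice_eval (- qi) X \<in> slice (- qi)"
    "slice_eval qj X \<in> slice qj" "slice_eval (- qj) X \<in> slice (- qj)"
    using * by (simp_all add: uminus_imag_unit)
  then show "X = biscalar (bq0 X)"
    by (simp add: slice_eq_range slice_eval_eq_re_im image_iff slice_embed_def quat_eq_iff
        biquat_eq_iff complex_eq_iff) auto
qed (metis slice_eval_biscalar slice_eq_range rangeI)

lemma biscalar_left_commute: "X * (biscalar c * Y) = biscalar c * (X * Y)"
  by (metis biscalar_commute mult.assoc)

lemma biquat_of_mult: "biquat_of (p * q) = biquat_of p * biquat_of q"
  and biquat_of_uminus: "biquat_of (- p) = - biquat_of p"
  and biquat_of_1: "biquat_of 1 = 1"
  by (simp_all add: biquat_eq_iff)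

text \<open>Replaces the units \<open>i\<close>, \<open>j\<close>, \<open>k\<close> by \<open>I\<close>, \<open>J\<close>, \<open>I * J\<close> and keeps the complex coefficients.\<close>
definition biframe :: "quat \<Rightarrow> quat \<Rightarrow> biquat \<Rightarrow> biquat"
  where "biframe I J X = biscalar (bq0 X) + biscalar (bq1 X) * biquat_of I +
    biscalar (bq2 X) * biquat_of J + biscalar (bq3 X) * (biquat_of I * biquat_of J)"

lemma orthogonal_imag_units_anticommute:
  assumes "I \<in> \<S>" "J \<in> \<S>" "orthogonal I J"
  shows "J * I = - (I * J)"
  using assms by (simp add: orthogonal_def inner_quat_def imag_units_iff quat_eq_iff algebra_simps)

lemma biframe_add: "biframe I J (X + Y) = biframe I J X + biframe I J Y"
  and biframe_biscalar: "biframe I J (biscalar c) = biscalar c"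
  and biframe_biquat_of: "biframe I J (biquat_of qi) = biquat_of I"
    "biframe I J (biquat_of qj) = biquat_of J"
  and biframe_id: "biframe qi qj X = X"
  by (simp_all add: biframe_def biquat_eq_iff algebra_simps)

text \<open>The product of biquaternions is determined by bilinearity and the relations
  \<open>i * i = j * j = - 1\<close> and \<open>j * i = - (i * j)\<close>, which \<open>I\<close> and \<open>J\<close> satisfy as well.\<close>
lemma biframe_mult:
  assumes "I \<in> \<S>" "J \<in> \<S>" "orthogonal I J"
  shows "biframe I J (X * Y) = biframe I J X * biframe I J Y"
proof -
  define u v where "u = biquat_of I" and "v = biquat_of J"
  have sq: "u * u = - 1" "v * v = - 1" "v * u = - (u * v)"
    using assms imag_units_square orthogonal_imag_units_anticommute [OF assms]
    by (simp_all add: u_def v_def biquat_of_uminus biquat_of_1 flip: biquat_of_mult)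
  then have sq': "u * (u * Z) = - Z" "v * (v * Z) = - Z" "v * (u * Z) = - (u * (v * Z))" for Z
    by (simp_all flip: mult.assoc)
  have sc: "biscalar a * biscalar b = biscalar (a * b)"
    "biscalar a * (biscalar b * Z) = biscalar (a * b) * Z"
    "u * biscalar a = biscalar a * u" "v * biscalar a = biscalar a * v"
    "u * (biscalar a * Z) = biscalar a * (u * Z)" "v * (biscalar a * Z) = biscalar a * (v * Z)"
    for a b Z
    by (rule biscalar_mult [symmetric] biscalar_commute [symmetric] biscalar_left_commute
        | simp only: biscalar_mult mult.assoc)+
  have add: "biscalar (a + b) = biscalar a + biscalar b" "biscalar (a - b) = biscalar a - biscalar b"
    for a b by (simp_all add: biquat_eq_iff)
  show ?thesis
    unfolding biframe_def u_def [symmetric] v_def [symmetric] biquat_sel add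
    by (simp add: distrib_left distrib_right left_diff_distrib mult.assoc sq sq' sc)
qed

text \<open>The components of \<open>X\<close> are, up to sign, the scalar parts of \<open>X\<close> times 1, \<open>i\<close>, \<open>j\<close>, \<open>k\<close>, and the
  scalar part is not changed by \<open>biframe\<close>.\<close>
lemma biframe_inject:
  assumes "I \<in> \<S>" "J \<in> \<S>" "orthogonal I J"
  shows "biframe I J X = biframe I J Y \<longleftrightarrow> X = Y"
proof
  assume eq: "biframe I J X = biframe I J Y"
  have re: "re I = 0" "re J = 0" "re (I * J) = 0"
    using assms by (simp_all add: imag_units_iff orthogonal_def inner_quat_def algebra_simps)
  have "bq0 (biframe I J Z) = bq0 Z" for Z
    using re(1,2) unfolding biframe_def biquat_of_mult [symmetric]
    by (simp only: biquat_sel biquat_basic_sel re) simp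
  then have "bq0 (X * Z) = bq0 (Y * Z)" for Z
    using eq biframe_mult [OF assms] by metis
  from this [of 1] this [of "biquat_of qi"] this [of "biquat_of qj"] this [of "biquat_of qk"]
  show "X = Y" by (simp add: biquat_eq_iff)
qed simp

lemma biframe_biell:
  "biframe I J (biell_plus qi) = biell_plus I" "biframe I J (biell_minus qi) = biell_minus I"
  by (simp_all add: biframe_def biell_plus_def biell_minus_def biquat_eq_iff)

lemma biconj_mult: "biconj (X * Y) = biconj Y * biconj X"
  by (simp add: biquat_eq_iff)

lemma biconj_biframe:
  assumes "I \<in> \<S>" "J \<in> \<S>" "orthogonal I J"
  shows "biconj (biframe I J X) = biframe I J (biconj X)"
proof -
  have "re I = 0" "re J = 0" "re (I * J) = 0"
    using assms by (simp_all add: imag_units_iff orthogonal_def inner_quat_def algebra_simps)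
  then show ?thesis
    unfolding biframe_def biquat_of_mult [symmetric]
    by (simp only: biquat_eq_iff biquat_sel biquat_basic_sel) simp
qed

locale semi_regular_algebra =
  fixes \<Omega> :: "quat set"
  assumes product_domain: "product_domain \<Omega>"
begin

abbreviation D :: "complex set" where "D \<equiv> params \<Omega>"

lemmas D = product_domain_params [OF product_domain]

lemma eventually_D: "\<forall>\<^sub>\<approx>z\<in>D. 0 < Im z"
  using eventually_in_cosparse [OF order_refl D(1)] by eventually_elim (rule D(4))

lemma not_eventually_False: "\<not> (\<forall>\<^sub>\<approx>z\<in>D. False)"
  using D(3) cosparse_eq_bot_iff' trivial_limit_def by metis

lemma meromorphic_constant_or_avoid:
  "k meromorphic_on D \<Longrightarrow> (\<forall>\<^sub>\<approx>z\<in>D. k z = c) \<or> (\<forall>\<^sub>\<approx>z\<in>D. k z \<noteq> c)"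
  using meromorphic_imp_constant_or_avoid [OF _ D(1,2)] .

text \<open>\<open>A\<close> is a meromorphic stem of \<open>f\<close>.  Prescribing it only generically makes the predicate invariant
  under the identification of semi-regular functions.\<close>
definition has_stem :: "(quat \<Rightarrow> quat) \<Rightarrow> (complex \<Rightarrow> biquat) \<Rightarrow> bool"
  where "has_stem f A \<longleftrightarrow> bimero A D \<and> (\<forall>\<^sub>\<approx>z\<in>D. slice_at f z \<and> stem f z = A z)"

lemma semi_regular_with_has_stem:
  assumes "has_stem f A" "\<forall>\<^sub>\<approx>z\<in>D. P z"
  shows "\<exists>W. semi_regular_with \<Omega> W f \<and> (\<forall>z\<in>params W. P z)"
proof (rule bimero_imp_semi_regular [OF product_domain _ _ assms(2)])
  have *: "\<forall>\<^sub>\<approx>z\<in>D. slice_at f z \<and> stem f z = A z" "bimero A D"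
    using assms(1) by (simp_all add: has_stem_def)
  show "bimero (stem f) D"
    by (rule bimero_cong [OF *(2)]) (use *(1) in eventually_elim, simp)
  show "\<forall>\<^sub>\<approx>z\<in>D. slice_at f z"
    using *(1) by eventually_elim simp
qed

lemma semi_regular_with_imp_has_stem:
  assumes "semi_regular_with \<Omega> W f"
  shows "has_stem f (stem f)"
proof -
  note * = semi_regular_imp_bimero [OF product_domain assms]
  have "\<forall>\<^sub>\<approx>z\<in>D. slice_at f z \<and> stem f z = stem f z"
    using *(2) by eventually_elim (simp add: *(3))
  with *(1) show ?thesis by (simp add: has_stem_def)
qed

lemma SEM_has_stem: "f \<in> SEM \<Omega> \<Longrightarrow> has_stem f (stem f)"
  using semi_regular_with_imp_has_stem by (auto simp: SEM_def)

lemma has_stem_SEM: "has_stem f A \<Longrightarrow> f \<in> SEM \<Omega>"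
  using semi_regular_with_has_stem [of f A "\<lambda>_. True"] by (auto simp: SEM_def)

text \<open>Functions that agree on the intersection of their domains of regularity have the same stem
  there, and this intersection is cosparse.  Conversely the domains can be chosen inside the set where
  the stems agree.\<close>
lemma sem_eq_iff:
  assumes f: "has_stem f A" and g: "has_stem g B"
  shows "sem_eq \<Omega> f g \<longleftrightarrow> (\<forall>\<^sub>\<approx>z\<in>D. A z = B z)"
proof
  have st: "\<forall>\<^sub>\<approx>z\<in>D. slice_at f z \<and> stem f z = A z" "\<forall>\<^sub>\<approx>z\<in>D. slice_at g z \<and> stem g z = B z"
    using f g by (simp_all add: has_stem_def)
  {
    assume "sem_eq \<Omega> f g"
    then obtain V W where V: "semi_regular_with \<Omega> V f" and W: "semi_regular_with \<Omega> W g"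
      and eq: "\<And>q. q \<in> V \<inter> W \<Longrightarrow> f q = g q"
      by (auto simp: sem_eq_def)
    have circ: "circular V" "circular W" using V W by (simp_all add: semi_regular_with_def)
    show "\<forall>\<^sub>\<approx>z\<in>D. A z = B z"
      using semi_regular_imp_bimero(2) [OF product_domain V]
        semi_regular_imp_bimero(2) [OF product_domain W] eventually_D st
    proof eventually_elim
      case (elim z)
      have "f (slice_embed I z) = g (slice_embed I z)" if "I \<in> \<S>" for I
        using elim that circ by (intro eq) (simp add: slice_embed_in_circular_iff)
      from this [of qi] this [of "- qi"] have "stem f z = stem g z"
        by (simp add: stem_def stem_re_def stem_im_def uminus_imag_unit)
      with elim show ?case by simp
    qed
  }
  assume eq: "\<forall>\<^sub>\<approx>z\<in>D. A z = B z"
  have P: "\<forall>\<^sub>\<approx>z\<in>D. slice_at f z \<and> slice_at g z \<and> stem f z = stem g z \<and> 0 < Im z"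
    using st eq eventually_D by eventually_elim simp
  obtain V where V: "semi_regular_with \<Omega> V f"
    "\<And>z. z \<in> params V \<Longrightarrow> slice_at f z \<and> slice_at g z \<and> stem f z = stem g z \<and> 0 < Im z"
    using semi_regular_with_has_stem [OF f P] by auto
  obtain W where W: "semi_regular_with \<Omega> W g"
    using semi_regular_with_has_stem [OF g P] by auto
  have "f q = g q" if q: "q \<in> V" for q
  proof -
    from q have *: "slice_at f (sphere_param q)" "slice_at g (sphere_param q)"
      "stem f (sphere_param q) = stem g (sphere_param q)" "0 < Im (sphere_param q)"
      using V(2) by blast+
    then have "qvec q \<noteq> 0" by (simp add: sphere_param_def)
    then show ?thesis
      using slice_atD [OF *(1)] slice_atD [OF *(2)] *(3)
      by (metis Jfun_imag_unit slice_embed_Jfun_sphere_param)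
  qed
  with V(1) W show "sem_eq \<Omega> f g" by (auto simp: sem_eq_def)
qed

text \<open>A slice preserving function has a scalar stem and conversely, so that \<open>SEM_R\<close> is the field
  of meromorphic functions.\<close>
lemma SEM_R_has_stem:
  assumes "f \<in> SEM_R \<Omega>"
  obtains a where "a meromorphic_on D" "has_stem f (\<lambda>z. biscalar (a z))"
proof -
  from assms obtain W where W: "semi_regular_with \<Omega> W f" "slice_preserving W f"
    by (auto simp: SEM_R_def)
  note * = semi_regular_imp_bimero [OF product_domain W(1)]
  have circ: "circular W" using W by (simp add: semi_regular_with_def)
  have "\<forall>\<^sub>\<approx>z\<in>D. slice_at f z \<and> stem f z = biscalar (bq0 (stem f z))"
    using *(2) eventually_D
  proof eventually_elim
    case (elim z)
    have sl: "slice_at f z" using *(3) elim by blast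
    have "\<forall>I\<in>\<S>. slice_eval I (stem f z) \<in> slice I"
    proof
      fix I assume I: "I \<in> \<S>"
      then have "slice_embed I z \<in> W \<inter> slice I"
        using elim circ by (simp add: slice_embed_in_circular_iff slice_eq_range)
      with W(2) I have "f (slice_embed I z) \<in> slice I"
        unfolding slice_preserving_def by blast
      then show "slice_eval I (stem f z) \<in> slice I"
        by (simp add: slice_atD [OF sl I])
    qed
    with sl show ?case by (simp only: slice_eval_preserves_slices_iff simp_thms)
  qed
  with *(1) have "has_stem f (\<lambda>z. biscalar (bq0 (stem f z)))"
    by (simp add: has_stem_def bimero_intros bimero_component)
  with bimero_component(1) [OF *(1)] show ?thesis by (rule that)
qed

lemma has_stem_SEM_R:
  assumes "has_stem f (\<lambda>z. biscalar (a z))"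
  shows "f \<in> SEM_R \<Omega>"
proof -
  have "\<forall>\<^sub>\<approx>z\<in>D. slice_at f z \<and> stem f z = biscalar (a z)"
    using assms by (simp add: has_stem_def)
  from semi_regular_with_has_stem [OF assms this] obtain W where
    W: "semi_regular_with \<Omega> W f" "\<forall>z\<in>params W. slice_at f z \<and> stem f z = biscalar (a z)"
    by blast
  have circ: "circular W" and "W \<subseteq> \<Omega>" using W by (simp_all add: semi_regular_with_def)
  then have pos: "z \<in> params W \<Longrightarrow> 0 < Im z" for z using D(4) by blast
  have key: "f (slice_embed I z) \<in> slice I"
    if "I \<in> \<S>" "z \<in> params W" for I z
    using W(2) that by (auto simp: slice_atD slice_eval_biscalar slice_eq_range)
  have "f q \<in> slice I" if I: "I \<in> \<S>" and q: "q \<in> W" "q \<in> slice I" for I q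
  proof -
    obtain w where w: "q = slice_embed I w" using q by (auto simp: slice_eq_range)
    show ?thesis
    proof (cases "0 \<le> Im w")
      case True
      then have "w \<in> params W" using I circ q w by (simp add: slice_embed_in_circular_iff)
      with key I w show ?thesis by simp
    next
      case False
      have w': "q = slice_embed (- I) (cnj w)" by (simp add: w flip: slice_embed_cnj)
      with False have "cnj w \<in> params W"
        using uminus_imag_unit [OF I] circ q by (simp flip: slice_embed_in_circular_iff)
      with key [OF uminus_imag_unit [OF I]] w' have "f q \<in> slice (- I)" by simp
      then show ?thesis
        by (auto simp: slice_eq_range) (metis complex_cnj_cnj rangeI slice_embed_cnj)
    qed
  qed
  with W(1) show ?thesis by (auto simp: SEM_R_def slice_preserving_def)
qed

lemma has_stemI:
  assumes "bimero A D" "\<And>z. 0 < Im z \<Longrightarrow> slice_at f z" "\<And>z. 0 < Im z \<Longrightarrow> stem f z = A z"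
  shows "has_stem f A"
  unfolding has_stem_def using assms eventually_D by (auto elim: eventually_mono)

lemma has_stem_cong:
  assumes "has_stem f A" "\<forall>\<^sub>\<approx>z\<in>D. A z = B z"
  shows "has_stem f B"
proof -
  have "\<forall>\<^sub>\<approx>z\<in>D. slice_at f z \<and> stem f z = A z" using assms by (simp add: has_stem_def)
  with assms(2) have "\<forall>\<^sub>\<approx>z\<in>D. slice_at f z \<and> stem f z = B z" by eventually_elim simp
  with bimero_cong [OF _ assms(2)] assms(1) show ?thesis by (simp add: has_stem_def)
qed

lemma has_stem_0: "has_stem 0 (\<lambda>z. 0)"
  and has_stem_1: "has_stem 1 (\<lambda>z. 1)"
  and has_stem_cst: "has_stem (cst c) (\<lambda>z. biquat_of c)"
  and has_stem_ell_plus: "has_stem (ell_plus I) (\<lambda>z. biell_plus I)"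
  and has_stem_ell_minus: "has_stem (ell_minus I) (\<lambda>z. biell_minus I)"
  and has_stem_biquat_lift: "bimero A D \<Longrightarrow> has_stem (biquat_lift A) A"
  by (auto intro!: has_stemI bimero_intros simp: stem_0 stem_1 stem_cst stem_ell stem_biquat_lift)

lemma has_stem_add:
  assumes "has_stem f A" "has_stem g B" shows "has_stem (f + g) (\<lambda>z. A z + B z)"
proof -
  have "\<forall>\<^sub>\<approx>z\<in>D. slice_at f z \<and> stem f z = A z" "\<forall>\<^sub>\<approx>z\<in>D. slice_at g z \<and> stem g z = B z"
    using assms by (simp_all add: has_stem_def)
  then have "\<forall>\<^sub>\<approx>z\<in>D. slice_at (f + g) z \<and> stem (f + g) z = A z + B z"
    by eventually_elim (simp add: stem_add)
  with assms show ?thesis by (simp add: has_stem_def bimero_intros)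
qed

lemma has_stem_diff:
  assumes "has_stem f A" "has_stem g B" shows "has_stem (f - g) (\<lambda>z. A z - B z)"
proof -
  have "\<forall>\<^sub>\<approx>z\<in>D. slice_at f z \<and> stem f z = A z" "\<forall>\<^sub>\<approx>z\<in>D. slice_at g z \<and> stem g z = B z"
    using assms by (simp_all add: has_stem_def)
  then have "\<forall>\<^sub>\<approx>z\<in>D. slice_at (f - g) z \<and> stem (f - g) z = A z - B z"
    by eventually_elim (simp add: stem_diff)
  with assms show ?thesis by (simp add: has_stem_def bimero_intros)
qed

lemma has_stem_star:
  assumes "has_stem f A" "has_stem g B" shows "has_stem (f \<star> g) (\<lambda>z. A z * B z)"
proof -
  have "\<forall>\<^sub>\<approx>z\<in>D. slice_at f z \<and> stem f z = A z" "\<forall>\<^sub>\<approx>z\<in>D. slice_at g z \<and> stem g z = B z"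
    using assms by (simp_all add: has_stem_def)
  then have "\<forall>\<^sub>\<approx>z\<in>D. slice_at (f \<star> g) z \<and> stem (f \<star> g) z = A z * B z"
    by eventually_elim (simp add: stem_star)
  with assms show ?thesis by (simp add: has_stem_def bimero_intros)
qed

lemmas has_stem_intros = has_stem_0 has_stem_1 has_stem_cst has_stem_ell_plus has_stem_ell_minus
  has_stem_add has_stem_diff has_stem_star

text \<open>The stems of the components are the components of the stem, whichever representatives
  \<open>reg_conj\<close> chooses.\<close>
lemma has_stem_reg_conj:
  assumes "has_stem f A" shows "has_stem (reg_conj \<Omega> f) (\<lambda>z. biconj (A z))"
proof -
  have comp: "bimero A D" using assms by (simp add: has_stem_def)
  define P where "P g \<longleftrightarrow> (\<exists>f0\<in>SEM_R \<Omega>. \<exists>f1\<in>SEM_R \<Omega>. \<exists>f2\<in>SEM_R \<Omega>. \<exists>f3\<in>SEM_R \<Omega>.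
    sem_eq \<Omega> f (f0 + (f1 \<star> cst qi + f2 \<star> cst qj + f3 \<star> cst qk)) \<and>
    g = f0 - (f1 \<star> cst qi + f2 \<star> cst qj + f3 \<star> cst qk))" for g
  have "\<exists>g. P g"
  proof -
    let ?l = "\<lambda>b. biquat_lift (\<lambda>z. biscalar (b (A z)))"
    have l: "has_stem (?l bq0) (\<lambda>z. biscalar (bq0 (A z)))"
      "has_stem (?l bq1) (\<lambda>z. biscalar (bq1 (A z)))"
      "has_stem (?l bq2) (\<lambda>z. biscalar (bq2 (A z)))"
      "has_stem (?l bq3) (\<lambda>z. biscalar (bq3 (A z)))"
      using comp by (simp_all add: has_stem_biquat_lift bimero_intros bimero_component)
    have "sem_eq \<Omega> f (?l bq0 + (?l bq1 \<star> cst qi + ?l bq2 \<star> cst qj + ?l bq3 \<star> cst qk))"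
      by (subst sem_eq_iff [OF assms]) (rule has_stem_intros l | simp add: biquat_eq_iff)+
    then show ?thesis
      unfolding P_def using l [THEN has_stem_SEM_R] by blast
  qed
  then have "P (reg_conj \<Omega> f)"
    unfolding reg_conj_def P_def by (rule someI_ex)
  then obtain f0 f1 f2 f3 where R: "f0 \<in> SEM_R \<Omega>" "f1 \<in> SEM_R \<Omega>" "f2 \<in> SEM_R \<Omega>" "f3 \<in> SEM_R \<Omega>"
    and eq: "sem_eq \<Omega> f (f0 + (f1 \<star> cst qi + f2 \<star> cst qj + f3 \<star> cst qk))"
    and g: "reg_conj \<Omega> f = f0 - (f1 \<star> cst qi + f2 \<star> cst qj + f3 \<star> cst qk)"
    unfolding P_def by blast
  obtain a0 a1 a2 a3 where a: "has_stem f0 (\<lambda>z. biscalar (a0 z))" "has_stem f1 (\<lambda>z. biscalar (a1 z))"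
    "has_stem f2 (\<lambda>z. biscalar (a2 z))" "has_stem f3 (\<lambda>z. biscalar (a3 z))"
    using R SEM_R_has_stem by metis
  let ?v = "\<lambda>z. biscalar (a1 z) * biquat_of qi + biscalar (a2 z) * biquat_of qj +
    biscalar (a3 z) * biquat_of qk"
  have "has_stem (f0 + (f1 \<star> cst qi + f2 \<star> cst qj + f3 \<star> cst qk)) (\<lambda>z. biscalar (a0 z) + ?v z)"
    by (intro has_stem_intros a)
  with eq have "\<forall>\<^sub>\<approx>z\<in>D. A z = biscalar (a0 z) + ?v z"
    by (simp only: sem_eq_iff [OF assms])
  then have "\<forall>\<^sub>\<approx>z\<in>D. biscalar (a0 z) - ?v z = biconj (A z)"
    by eventually_elim (simp add: biquat_eq_iff)
  moreover have "has_stem (reg_conj \<Omega> f) (\<lambda>z. biscalar (a0 z) - ?v z)"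
    unfolding g by (intro has_stem_intros a)
  ultimately show ?thesis by (rule has_stem_cong [rotated])
qed

text \<open>Pointwise inversion of the slice preserving function \<open>f\<^sup>s\<close> inverts its scalar stem; where the
  latter vanishes both give 0.\<close>
lemma has_stem_star_inv:
  assumes "has_stem f A" shows "has_stem (star_inv \<Omega> f) (\<lambda>z. biinverse (A z))"
proof -
  have mero: "bimero A D" using assms by (simp add: has_stem_def)
  have "has_stem (reg_symm \<Omega> f) (\<lambda>z. biscalar (binorm (A z)))"
    unfolding reg_symm_def biquat_mult_biconj [symmetric]
    by (intro has_stem_intros has_stem_reg_conj assms)
  then have "\<forall>\<^sub>\<approx>z\<in>D. slice_at (reg_symm \<Omega> f) z \<and> stem (reg_symm \<Omega> f) z = biscalar (binorm (A z))"
    by (simp add: has_stem_def)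
  then have "\<forall>\<^sub>\<approx>z\<in>D. slice_at (\<lambda>q. inverse (reg_symm \<Omega> f q)) z \<and>
      stem (\<lambda>q. inverse (reg_symm \<Omega> f q)) z = biscalar (inverse (binorm (A z)))"
    by eventually_elim (simp add: stem_inverse)
  moreover have "bimero (\<lambda>z. biscalar (inverse (binorm (A z)))) D"
    by (intro bimero_intros meromorphic_intros bimero_component mero)
  ultimately have "has_stem (\<lambda>q. inverse (reg_symm \<Omega> f q)) (\<lambda>z. biscalar (inverse (binorm (A z))))"
    by (simp add: has_stem_def)
  then show ?thesis
    unfolding star_inv_def biinverse_def
    by (intro has_stem_intros has_stem_reg_conj assms)
qed

text \<open>Necessity holds because \<open>binorm\<close> is multiplicative, sufficiency because \<open>star_inv\<close> has the stem
  \<open>biinverse (A z)\<close>.\<close>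
lemma star_invertible_iff:
  assumes f: "has_stem f A"
  shows "star_invertible \<Omega> f \<longleftrightarrow> (\<forall>\<^sub>\<approx>z\<in>D. binorm (A z) \<noteq> 0)"
proof
  assume "star_invertible \<Omega> f"
  then obtain g where g: "g \<in> SEM \<Omega>" "sem_eq \<Omega> (f \<star> g) 1"
    by (auto simp: star_invertible_def)
  have "\<forall>\<^sub>\<approx>z\<in>D. A z * stem g z = 1"
    using g(2) sem_eq_iff [OF has_stem_star [OF f SEM_has_stem [OF g(1)]] has_stem_1] by simp
  then show "\<forall>\<^sub>\<approx>z\<in>D. binorm (A z) \<noteq> 0"
  proof eventually_elim
    case (elim z)
    then have "binorm (A z) * binorm (stem g z) = 1"
      by (metis binorm_mult binorm_def biquat_sel(5-8) add.right_neutral one_power2 zero_power2)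
    then show ?case by auto
  qed
next
  assume *: "\<forall>\<^sub>\<approx>z\<in>D. binorm (A z) \<noteq> 0"
  note inv = has_stem_star_inv [OF f]
  have "\<forall>\<^sub>\<approx>z\<in>D. A z * biinverse (A z) = 1" "\<forall>\<^sub>\<approx>z\<in>D. biinverse (A z) * A z = 1"
    using * by (eventually_elim, simp add: biinverse)+
  then show "star_invertible \<Omega> f"
    unfolding star_invertible_def
    using has_stem_SEM [OF f] has_stem_SEM [OF inv]
      sem_eq_iff [OF has_stem_star [OF f inv] has_stem_1]
      sem_eq_iff [OF has_stem_star [OF inv f] has_stem_1] by blast
qed

lemma star_idempotent_iff:
  assumes f: "has_stem f A"
  shows "star_idempotent \<Omega> f \<longleftrightarrow>
    \<not> (\<forall>\<^sub>\<approx>z\<in>D. A z = 0) \<and> \<not> (\<forall>\<^sub>\<approx>z\<in>D. A z = 1) \<and> (\<forall>\<^sub>\<approx>z\<in>D. A z * A z = A z)"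
  unfolding star_idempotent_def
  using has_stem_SEM [OF f] sem_eq_iff [OF f has_stem_0] sem_eq_iff [OF f has_stem_1]
    sem_eq_iff [OF has_stem_star [OF f f] f] by blast

end

section \<open>Idempotent biquaternions and their annihilators\<close>

definition biconjugate :: "biquat \<Rightarrow> biquat \<Rightarrow> biquat"
  where "biconjugate F X = F * X * biinverse F"

lemma biconjugate_mult:
  "binorm F \<noteq> 0 \<Longrightarrow> biconjugate F X * biconjugate F Y = biconjugate F (X * Y)"
  by (simp add: biconjugate_def mult.assoc) (simp add: biinverse(2) flip: mult.assoc [of "biinverse F" F])

lemma biconjugate_inverse:
  assumes "binorm F \<noteq> 0"
  shows "biinverse F * biconjugate F X * F = X" "biconjugate F (biinverse F * X * F) = X"
proof -
  have "biinverse F * biconjugate F X * F = (biinverse F * F) * X * (biinverse F * F)"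
    "biconjugate F (biinverse F * X * F) = (F * biinverse F) * X * (F * biinverse F)"
    by (simp_all only: biconjugate_def mult.assoc)
  then show "biinverse F * biconjugate F X * F = X" "biconjugate F (biinverse F * X * F) = X"
    using assms by (simp_all add: biinverse)
qed

lemma biconjugate_eq_iff:
  assumes "binorm F \<noteq> 0"
  shows "biconjugate F X = biconjugate F Y \<longleftrightarrow> X = Y"
    and "biconjugate F X = 0 \<longleftrightarrow> X = 0" and "biconjugate F X = 1 \<longleftrightarrow> X = 1"
proof -
  show *: "biconjugate F X = biconjugate F Y \<longleftrightarrow> X = Y" for X Y
    using biconjugate_inverse(1) [OF assms] by metis
  show "biconjugate F X = 0 \<longleftrightarrow> X = 0" "biconjugate F X = 1 \<longleftrightarrow> X = 1"
    using * [of X 0] * [of X 1] assms by (simp_all add: biconjugate_def biinverse)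
qed

text \<open>Here \<open>biconj\<close> reverses products and exchanges \<open>F\<close> with \<open>biinverse F\<close> up to scalars
  that cancel.\<close>
lemma biconj_biconjugate: "biconj (biconjugate F X) = biconjugate F (biconj X)"
proof -
  have [simp]: "biconj (biscalar c) = biscalar c" "biconj (biconj Y) = Y" for c Y
    by (simp_all add: biquat_eq_iff)
  show ?thesis
    unfolding biconjugate_def biinverse_def biconj_mult
    by (simp add: mult.assoc biscalar_commute [of _ "biconj F"] biscalar_left_commute [of F])
       (metis biscalar_commute mult.assoc)
qed

abbreviation lp :: biquat where "lp \<equiv> biell_plus qi"
abbreviation lm :: biquat where "lm \<equiv> biell_minus qi"

definition left_form :: "complex \<Rightarrow> complex \<Rightarrow> biquat"
  where "left_form a b = lm * (biscalar a + biscalar b * biquat_of qj)"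

definition conj_form :: "complex \<Rightarrow> complex \<Rightarrow> complex \<Rightarrow> biquat"
  where "conj_form a0 a1 b = biscalar a0 + biscalar a1 * biquat_of qi + biscalar b * lm * biquat_of qj"

definition two_sided_form :: "complex \<Rightarrow> complex \<Rightarrow> complex \<Rightarrow> biquat"
  where "two_sided_form a b2 b3 =
    biscalar a * lm + (biscalar b2 + biscalar b3 * biquat_of qi) * biquat_of qj"

lemma normal_form_sel:
  "left_form a b = Biquat (a / 2) (\<i> * a / 2) (b / 2) (\<i> * b / 2)"
  "conj_form a0 a1 b = Biquat a0 a1 (b / 2) (\<i> * b / 2)"
  "two_sided_form a b2 b3 = Biquat (a / 2) (\<i> * a / 2) b2 b3"
  by (simp_all add: biquat_eq_iff left_form_def conj_form_def two_sided_form_def biell_minus_def algebra_simps)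

lemma lp_sel: "lp = Biquat (1/2) (- \<i> / 2) 0 0" and lm_sel: "lm = Biquat (1/2) (\<i> / 2) 0 0"
  by (simp_all add: biquat_eq_iff biell_plus_def biell_minus_def)

lemma biconj_lp: "biconj lp = lm"
  by (simp add: biquat_eq_iff lp_sel lm_sel)

text \<open>Since \<open>lm * qi = - \<i> * lm\<close>, multiples of \<open>lm\<close> by \<open>1\<close> and \<open>qi\<close> are complex multiples of \<open>lm\<close>,
  which gives the combinations \<open>bq0 X - \<i> * bq1 X\<close> and \<open>bq2 X - \<i> * bq3 X\<close>.  Moreover \<open>qi\<close> commutes
  with \<open>lp\<close> and \<open>lm\<close>, while moving \<open>qj\<close> past one of them turns it into the other.\<close>
lemma annihilated_iff_form:
  "lp * X = 0 \<longleftrightarrow> X = left_form (bq0 X - \<i> * bq1 X) (bq2 X - \<i> * bq3 X)"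
  "lp * X * lm = 0 \<longleftrightarrow> X = conj_form (bq0 X) (bq1 X) (bq2 X - \<i> * bq3 X)"
  "lp * X * lp = 0 \<longleftrightarrow> X = two_sided_form (bq0 X - \<i> * bq1 X) (bq2 X) (bq3 X)"
  by (auto simp: biquat_eq_iff lp_sel lm_sel normal_form_sel complex_eq_iff) (simp_all add: field_simps)

lemma annihilated_form:
  "lp * left_form a b = 0" "lp * conj_form a0 a1 b * lm = 0" "lp * two_sided_form a b2 b3 * lp = 0"
  by (simp_all add: biquat_eq_iff lp_sel lm_sel normal_form_sel algebra_simps)

lemma left_form_idempotent:
  "left_form a b * left_form a b = left_form a b \<longleftrightarrow> a = 1 \<or> left_form a b = 0"
proof -
  have "left_form a b * left_form a b = biscalar a * left_form a b"
    by (simp add: biquat_eq_iff normal_form_sel algebra_simps)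
  moreover have "biscalar a * X = X \<longleftrightarrow> a = 1 \<or> X = 0" for X
    by (auto simp: biquat_eq_iff)
  ultimately show ?thesis by simp
qed

lemma quarter_minus_eq_half_iff: "1/4 - u = 1/2 \<longleftrightarrow> u = - (1/4)" for u :: complex
  by (auto simp: complex_eq_iff)

text \<open>The square of the form has scalar part \<open>a0 * a0 - a1 * a1\<close>, and its other components are those
  of the form multiplied by \<open>2 * a0\<close>.\<close>
lemma conj_form_idempotent:
  "conj_form a0 a1 b * conj_form a0 a1 b = conj_form a0 a1 b \<longleftrightarrow>
    a0 = 1/2 \<and> a1 * a1 = - (1/4) \<or> conj_form a0 a1 b = 0 \<or> conj_form a0 a1 b = 1"
proof -
  have sq: "conj_form a0 a1 b * conj_form a0 a1 b =
      Biquat (a0 * a0 - a1 * a1) (2 * a0 * a1) (a0 * b) (\<i> * (a0 * b))"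
    by (simp add: biquat_eq_iff normal_form_sel algebra_simps)
  show ?thesis
  proof (cases "a0 = 1/2")
    case True
    show ?thesis unfolding sq unfolding True
      using quarter_minus_eq_half_iff [of "a1 * a1"] by (auto simp: normal_form_sel biquat_eq_iff)
  next
    case False
    have "2 * a0 * a1 = a1 \<longleftrightarrow> a1 = 0" "a0 * b = b / 2 \<longleftrightarrow> b = 0"
      using False by (auto simp: field_simps)
    then show ?thesis unfolding sq using False
      by (auto simp: normal_form_sel biquat_eq_iff)
  qed
qed

lemma two_sided_form_idempotent:
  "two_sided_form a b2 b3 * two_sided_form a b2 b3 = two_sided_form a b2 b3 \<longleftrightarrow>
    a = 1 \<and> b2 * b2 + b3 * b3 = 0 \<or> two_sided_form a b2 b3 = 0"
proof -
  have sq: "two_sided_form a b2 b3 * two_sided_form a b2 b3 =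
      Biquat (a * a / 2 - (b2 * b2 + b3 * b3)) (\<i> * (a * a) / 2) (a * b2) (a * b3)"
    by (simp add: biquat_eq_iff normal_form_sel algebra_simps)
  define n where "n = b2 * b2 + b3 * b3"
  have "n = 0" if "b2 = 0" "b3 = 0" using that by (simp add: n_def)
  then show ?thesis unfolding sq n_def [symmetric] by (auto simp: normal_form_sel biquat_eq_iff)
qed

text \<open>With \<open>i\<close> and \<open>j\<close> represented by complex matrices so that \<open>lp\<close> becomes the first matrix
  unit, the columns of the intertwiner span the image and the kernel of \<open>S\<close>.\<close>
lemma intertwiner:
  assumes "bq0 S = 1/2" "S * S = S"
  defines "a \<equiv> 1/2 + \<i> * bq1 S"
  defines "F \<equiv> if a = 0 then Biquat (bq2 S) (bq3 S) 0 (- \<i>)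
    else Biquat a 0 (- \<i> * bq3 S) (\<i> * bq2 S)"
  shows "binorm F \<noteq> 0" "S = biconjugate F lp"
proof -
  have N: "bq1 S * bq1 S + bq2 S * bq2 S + bq3 S * bq3 S = - (1/4)"
    using arg_cong [OF assms(2), of bq0] assms(1)
      quarter_minus_eq_half_iff [of "bq1 S * bq1 S + bq2 S * bq2 S + bq3 S * bq3 S"]
    by (simp add: diff_diff_eq)
  have a0: "bq1 S = \<i> / 2" "bq2 S * bq2 S + bq3 S * bq3 S = 0" if "a = 0"
  proof -
    from that show "bq1 S = \<i> / 2" by (auto simp: a_def complex_eq_iff)
    with N show "bq2 S * bq2 S + bq3 S * bq3 S = 0" by simp
  qed
  show nz: "binorm F \<noteq> 0"
  proof (cases "a = 0")
    case True
    with a0 show ?thesis by (simp add: F_def binorm_def power2_eq_square)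
  next
    case False
    have "binorm F = a * a - (bq2 S * bq2 S + bq3 S * bq3 S)"
      using False by (simp add: F_def binorm_def power2_eq_square algebra_simps)
    also have "\<dots> = a"
      using N by (simp add: a_def algebra_simps add_eq_0_iff)
    finally show ?thesis using False by simp
  qed
  have "S * F = F * lp"
  proof (cases "a = 0")
    case True
    have "bq3 S * bq3 S = - (bq2 S * bq2 S)"
      using a0(2) [OF True] by (metis add_eq_0_iff)
    then show ?thesis
      by (simp add: True F_def lp_sel biquat_eq_iff a0(1) assms(1) field_simps)
  next
    case False
    then show ?thesis
      using arg_cong [OF N, of "\<lambda>u. \<i> * u * 2"]
      by (simp add: F_def lp_sel biquat_eq_iff a_def assms(1) algebra_simps)
  qed
  then have "S * (F * biinverse F) = biconjugate F lp"
    by (simp add: biconjugate_def flip: mult.assoc)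
  with nz show "S = biconjugate F lp" by (simp add: biinverse)
qed

lemma bimero_Biquat:
  assumes "a meromorphic_on D" "b meromorphic_on D" "c meromorphic_on D" "d meromorphic_on D"
  shows "bimero (\<lambda>z. Biquat (a z) (b z) (c z) (d z)) D"
  using assms by (simp add: bimero_def)

lemma normal_form_biconjugate:
  assumes "I \<in> \<S>" "J \<in> \<S>" "orthogonal I J"
  shows "F * biell_plus I * biinverse F = biconjugate F (biframe I J lp)"
    and "F * biell_minus I * (biscalar a + biscalar b * biquat_of J) * biinverse F =
      biconjugate F (biframe I J (left_form a b))"
    and "F * (biscalar a0 + biscalar a1 * biquat_of I + biscalar b * biell_minus I * biquat_of J) *
      biinverse F = biconjugate F (biframe I J (conj_form a0 a1 b))"
    and "F * (biscalar a * biell_minus I +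
        (biscalar b2 + biscalar b3 * biquat_of I) * biquat_of J) * biinverse F =
      biconjugate F (biframe I J (two_sided_form a b2 b3))"
  by (simp_all add: biconjugate_def left_form_def conj_form_def two_sided_form_def biframe_biell biframe_add
      biframe_mult [OF assms] biframe_biscalar biframe_biquat_of mult.assoc)

lemma biframe_simps:
  assumes "I \<in> \<S>" "J \<in> \<S>" "orthogonal I J"
  shows "biframe I J X = 0 \<longleftrightarrow> X = 0" "biframe I J X = 1 \<longleftrightarrow> X = 1" "biframe I J 0 = 0"
  using biframe_inject [OF assms, of X 0] biframe_inject [OF assms, of X 1]
    biframe_biscalar [of I J 0] biframe_biscalar [of I J 1] by simp_all

section \<open>Idempotents among the semi-regular functions\<close>

context semi_regular_algebra
begin

text \<open>Apart from the scalar one, the components of \<open>S * S\<close> are those of \<open>S\<close> multiplied by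
  \<open>2 * bq0 S\<close>.  If \<open>bq0 S\<close> were not generically 1/2, then \<open>S\<close> would be generically scalar,
  hence 0 or 1.\<close>
lemma star_idempotent_stem:
  assumes "has_stem \<sigma> S" "star_idempotent \<Omega> \<sigma>"
  shows "\<forall>\<^sub>\<approx>z\<in>D. bq0 (S z) = 1/2 \<and> S z * S z = S z"
proof -
  have S: "\<not> (\<forall>\<^sub>\<approx>z\<in>D. S z = 0)" "\<not> (\<forall>\<^sub>\<approx>z\<in>D. S z = 1)" "\<forall>\<^sub>\<approx>z\<in>D. S z * S z = S z"
    using assms star_idempotent_iff by auto
  have mero: "(\<lambda>z. bq0 (S z)) meromorphic_on D"
    using assms(1) by (simp add: has_stem_def bimero_component)
  have "\<forall>\<^sub>\<approx>z\<in>D. bq0 (S z) = 1/2"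
  proof (rule ccontr)
    assume "\<not> ?thesis"
    with meromorphic_constant_or_avoid [OF mero] have ne: "\<forall>\<^sub>\<approx>z\<in>D. bq0 (S z) \<noteq> 1/2" by blast
    have scal: "\<forall>\<^sub>\<approx>z\<in>D. S z = biscalar (bq0 (S z)) \<and> (bq0 (S z) = 0 \<or> bq0 (S z) = 1)"
      using ne S(3)
    proof eventually_elim
      case (elim z)
      have c: "x = 0" if "bq0 (S z) * x + x * bq0 (S z) = x" for x
      proof -
        have "x * (2 * bq0 (S z) - 1) = 0" using that by (simp add: algebra_simps)
        with elim(1) show ?thesis by (auto simp: field_simps)
      qed
      have "bq1 (S z) = 0" "bq2 (S z) = 0" "bq3 (S z) = 0"
        using arg_cong [OF elim(2), of bq1] arg_cong [OF elim(2), of bq2]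
          arg_cong [OF elim(2), of bq3] by (simp_all add: c mult.commute)
      with arg_cong [OF elim(2), of bq0] show ?case by (auto simp: biquat_eq_iff)
    qed
    from meromorphic_constant_or_avoid [OF mero, of 0] show False
    proof
      assume "\<forall>\<^sub>\<approx>z\<in>D. bq0 (S z) = 0"
      with scal have "\<forall>\<^sub>\<approx>z\<in>D. S z = 0" by eventually_elim (metis biscalar_simps(1))
      with S(1) show False by blast
    next
      assume "\<forall>\<^sub>\<approx>z\<in>D. bq0 (S z) \<noteq> 0"
      with scal have "\<forall>\<^sub>\<approx>z\<in>D. S z = 1" by eventually_elim (metis biscalar_simps(2))
      with S(2) show False by blast
    qed
  qed
  with S(3) show ?thesis by eventually_elim simp
qed

text \<open>The case distinction in \<open>intertwiner\<close> is made once for the whole domain, because \<open>a\<close> is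
  generically zero or generically nonzero.\<close>
lemma star_idempotent_conjugate:
  assumes "has_stem \<sigma> S" "star_idempotent \<Omega> \<sigma>"
  obtains f F where "has_stem f F" "star_invertible \<Omega> f" "\<forall>\<^sub>\<approx>z\<in>D. S z = biconjugate (F z) lp"
proof -
  have mero: "bimero S D" using assms(1) by (simp add: has_stem_def)
  note st = star_idempotent_stem [OF assms]
  note comp = bimero_component [OF mero]
  define a where "a z = 1/2 + \<i> * bq1 (S z)" for z
  have a: "a meromorphic_on D" unfolding a_def by (intro meromorphic_intros comp)
  obtain F where F: "bimero F D" "\<forall>\<^sub>\<approx>z\<in>D. F z = (if a z = 0
      then Biquat (bq2 (S z)) (bq3 (S z)) 0 (- \<i>)
      else Biquat (a z) 0 (- \<i> * bq3 (S z)) (\<i> * bq2 (S z)))"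
    using meromorphic_constant_or_avoid [OF a, of 0]
  proof
    assume ev: "\<forall>\<^sub>\<approx>z\<in>D. a z = 0"
    show ?thesis
    proof (rule that)
      show "bimero (\<lambda>z. Biquat (bq2 (S z)) (bq3 (S z)) 0 (- \<i>)) D"
        by (intro bimero_Biquat meromorphic_intros comp)
    qed (use ev in eventually_elim, simp)
  next
    assume ev: "\<forall>\<^sub>\<approx>z\<in>D. a z \<noteq> 0"
    show ?thesis
    proof (rule that)
      show "bimero (\<lambda>z. Biquat (a z) 0 (- \<i> * bq3 (S z)) (\<i> * bq2 (S z))) D"
        by (intro bimero_Biquat meromorphic_intros comp a)
    qed (use ev in eventually_elim, simp)
  qed
  have *: "\<forall>\<^sub>\<approx>z\<in>D. binorm (F z) \<noteq> 0 \<and> S z = biconjugate (F z) lp"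
    using F(2) st
  proof eventually_elim
    case (elim z)
    with intertwiner [of "S z"] show ?case by (simp only: a_def) auto
  qed
  show ?thesis
  proof (rule that)
    show f: "has_stem (biquat_lift F) F" by (rule has_stem_biquat_lift [OF F(1)])
    show "star_invertible \<Omega> (biquat_lift F)"
      unfolding star_invertible_iff [OF f] using * by eventually_elim simp
    show "\<forall>\<^sub>\<approx>z\<in>D. S z = biconjugate (F z) lp" using * by eventually_elim simp
  qed
qed

lemma star_idempotent_biconjugate_iff:
  assumes r: "has_stem \<rho> R" and IJ: "I \<in> \<S>" "J \<in> \<S>" "orthogonal I J"
    and R: "\<forall>\<^sub>\<approx>z\<in>D. binorm (F z) \<noteq> 0 \<and> R z = biconjugate (F z) (biframe I J (X z))"
  shows "star_idempotent \<Omega> \<rho> \<longleftrightarrow>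
    \<not> (\<forall>\<^sub>\<approx>z\<in>D. X z = 0) \<and> \<not> (\<forall>\<^sub>\<approx>z\<in>D. X z = 1) \<and> (\<forall>\<^sub>\<approx>z\<in>D. X z * X z = X z)"
proof -
  have "\<forall>\<^sub>\<approx>z\<in>D. (R z = 0 \<longleftrightarrow> X z = 0) \<and> (R z = 1 \<longleftrightarrow> X z = 1) \<and>
      (R z * R z = R z \<longleftrightarrow> X z * X z = X z)"
    using R by eventually_elim
      (simp add: biconjugate_mult biconjugate_eq_iff biframe_simps [OF IJ] biframe_inject [OF IJ]
        flip: biframe_mult [OF IJ])
  note ev = this
  have "(\<forall>\<^sub>\<approx>z\<in>D. R z = 0) \<longleftrightarrow> (\<forall>\<^sub>\<approx>z\<in>D. X z = 0)" "(\<forall>\<^sub>\<approx>z\<in>D. R z = 1) \<longleftrightarrow> (\<forall>\<^sub>\<approx>z\<in>D. X z = 1)"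
    "(\<forall>\<^sub>\<approx>z\<in>D. R z * R z = R z) \<longleftrightarrow> (\<forall>\<^sub>\<approx>z\<in>D. X z * X z = X z)"
    using ev by (auto intro!: eventually_subst elim: eventually_mono)
  then show ?thesis using star_idempotent_iff [OF r] by simp
qed

text \<open>In each of the three cases the idempotency of the normal form is an alternative between
  the asserted condition and one of the trivial idempotents; the identity theorem makes one
  alternative hold throughout.\<close>
lemma nontrivial_idempotent_alternative:
  assumes k: "k meromorphic_on D" and X0: "(\<lambda>z. bq0 (X z)) meromorphic_on D"
    and alt: "\<And>z. X z * X z = X z \<longleftrightarrow> k z = c \<and> P z \<or> X z = 0 \<or> X z = 1"
    and triv: "\<And>z. X z = 0 \<or> X z = 1 \<Longrightarrow> k z = c \<Longrightarrow> False"
  shows "\<not> (\<forall>\<^sub>\<approx>z\<in>D. X z = 0) \<and> \<not> (\<forall>\<^sub>\<approx>z\<in>D. X z = 1) \<and> (\<forall>\<^sub>\<approx>z\<in>D. X z * X z = X z) \<longleftrightarrow>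
    (\<forall>\<^sub>\<approx>z\<in>D. k z = c \<and> P z)"
proof (intro iffI conjI)
  assume ev: "\<forall>\<^sub>\<approx>z\<in>D. k z = c \<and> P z"
  have "\<not> (\<forall>\<^sub>\<approx>z\<in>D. X z = Y)" if "\<And>z. k z = c \<Longrightarrow> P z \<Longrightarrow> X z \<noteq> Y" for Y
  proof
    assume "\<forall>\<^sub>\<approx>z\<in>D. X z = Y"
    with ev have "\<forall>\<^sub>\<approx>z\<in>D. False" by eventually_elim (use that in blast)
    then show False using not_eventually_False by blast
  qed
  with triv show "\<not> (\<forall>\<^sub>\<approx>z\<in>D. X z = 0)" "\<not> (\<forall>\<^sub>\<approx>z\<in>D. X z = 1)" by blast+
  show "\<forall>\<^sub>\<approx>z\<in>D. X z * X z = X z"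
    using ev by eventually_elim (simp add: alt)
next
  assume *: "\<not> (\<forall>\<^sub>\<approx>z\<in>D. X z = 0) \<and> \<not> (\<forall>\<^sub>\<approx>z\<in>D. X z = 1) \<and> (\<forall>\<^sub>\<approx>z\<in>D. X z * X z = X z)"
  then have sq: "\<forall>\<^sub>\<approx>z\<in>D. k z = c \<and> P z \<or> X z = 0 \<or> X z = 1" by (simp add: alt)
  have "\<forall>\<^sub>\<approx>z\<in>D. k z = c"
  proof (rule ccontr)
    assume "\<not> ?thesis"
    with meromorphic_constant_or_avoid [OF k] have "\<forall>\<^sub>\<approx>z\<in>D. k z \<noteq> c" by blast
    with sq have X: "\<forall>\<^sub>\<approx>z\<in>D. X z = 0 \<or> X z = 1" by eventually_elim blast
    from meromorphic_constant_or_avoid [OF X0, of 0] show False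
    proof
      assume "\<forall>\<^sub>\<approx>z\<in>D. bq0 (X z) = 0"
      with X have "\<forall>\<^sub>\<approx>z\<in>D. X z = 0" by eventually_elim auto
      with * show False by blast
    next
      assume "\<forall>\<^sub>\<approx>z\<in>D. bq0 (X z) \<noteq> 0"
      with X have "\<forall>\<^sub>\<approx>z\<in>D. X z = 1" by eventually_elim auto
      with * show False by blast
    qed
  qed
  with sq show "\<forall>\<^sub>\<approx>z\<in>D. k z = c \<and> P z"
    by eventually_elim (use triv in blast)
qed

section \<open>Annihilators of an idempotent\<close>

lemma orthogonal_qi_qj: "orthogonal qi qj"
  by (simp add: orthogonal_def inner_quat_def)

text \<open>Conjugating \<open>\<rho>\<close> back by the function that conjugates \<open>\<sigma>\<close> to \<open>lp\<close> makes \<open>lp\<close> and the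
  meromorphic \<open>X\<close> the only data of the problem.\<close>
lemma star_idempotent_common_conjugation:
  assumes \<sigma>: "has_stem \<sigma> S" "star_idempotent \<Omega> \<sigma>" and \<rho>: "has_stem \<rho> R"
  obtains f F X where "has_stem f F" "star_invertible \<Omega> f" "bimero X D"
    "\<forall>\<^sub>\<approx>z\<in>D. binorm (F z) \<noteq> 0 \<and> S z = biconjugate (F z) lp \<and> R z = biconjugate (F z) (X z)"
proof -
  obtain f F where f: "has_stem f F" "star_invertible \<Omega> f" "\<forall>\<^sub>\<approx>z\<in>D. S z = biconjugate (F z) lp"
    using star_idempotent_conjugate [OF \<sigma>] .
  have "has_stem (star_inv \<Omega> f \<star> \<rho> \<star> f) (\<lambda>z. biinverse (F z) * R z * F z)"
    by (intro has_stem_intros has_stem_star_inv f \<rho>)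
  then have "bimero (\<lambda>z. biinverse (F z) * R z * F z) D" by (simp add: has_stem_def)
  moreover have "\<forall>\<^sub>\<approx>z\<in>D. binorm (F z) \<noteq> 0"
    using f star_invertible_iff by blast
  with f(3) have "\<forall>\<^sub>\<approx>z\<in>D. binorm (F z) \<noteq> 0 \<and> S z = biconjugate (F z) lp \<and>
      R z = biconjugate (F z) (biinverse (F z) * R z * F z)"
    by eventually_elim (simp add: biconjugate_inverse)
  ultimately show ?thesis using that f by blast
qed

lemma star_invertible_has_stem:
  assumes "star_invertible \<Omega> f"
  shows "has_stem f (stem f)" "\<forall>\<^sub>\<approx>z\<in>D. binorm (stem f z) \<noteq> 0"
proof -
  show *: "has_stem f (stem f)"
    using assms by (simp add: star_invertible_def SEM_has_stem)
  show "\<forall>\<^sub>\<approx>z\<in>D. binorm (stem f z) \<noteq> 0"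
    using assms star_invertible_iff [OF *] by simp
qed

text \<open>The normal forms in the units \<open>I\<close> and \<open>J\<close> have as stems the conjugated images under \<open>biframe\<close> of the
  forms in \<open>i\<close> and \<open>j\<close>, so that only the latter have to be studied.\<close>
lemma normal_form_stem_iff:
  assumes \<sigma>: "has_stem \<sigma> S" and \<rho>: "has_stem \<rho> R" and f: "has_stem f F"
    and IJ: "I \<in> \<S>" "J \<in> \<S>" "orthogonal I J"
  shows "sem_eq \<Omega> \<sigma> (f \<star> ell_plus I \<star> star_inv \<Omega> f) \<longleftrightarrow>
      (\<forall>\<^sub>\<approx>z\<in>D. S z = biconjugate (F z) (biframe I J lp))"
    and "\<lbrakk>has_stem \<alpha> (\<lambda>z. biscalar (a z)); has_stem \<beta> (\<lambda>z. biscalar (b z))\<rbrakk> \<Longrightarrow>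
      sem_eq \<Omega> \<rho> (f \<star> ell_minus I \<star> (\<alpha> + \<beta> \<star> cst J) \<star> star_inv \<Omega> f) \<longleftrightarrow>
      (\<forall>\<^sub>\<approx>z\<in>D. R z = biconjugate (F z) (biframe I J (left_form (a z) (b z))))"
    and "\<lbrakk>has_stem \<alpha>\<^sub>0 (\<lambda>z. biscalar (a0 z)); has_stem \<alpha>\<^sub>1 (\<lambda>z. biscalar (a1 z));
        has_stem \<beta> (\<lambda>z. biscalar (b z))\<rbrakk> \<Longrightarrow>
      sem_eq \<Omega> \<rho> (f \<star> (\<alpha>\<^sub>0 + \<alpha>\<^sub>1 \<star> cst I + \<beta> \<star> ell_minus I \<star> cst J) \<star> star_inv \<Omega> f) \<longleftrightarrow>
      (\<forall>\<^sub>\<approx>z\<in>D. R z = biconjugate (F z) (biframe I J (conj_form (a0 z) (a1 z) (b z))))"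
    and "\<lbrakk>has_stem \<alpha> (\<lambda>z. biscalar (a z)); has_stem \<beta>\<^sub>2 (\<lambda>z. biscalar (b2 z));
        has_stem \<beta>\<^sub>3 (\<lambda>z. biscalar (b3 z))\<rbrakk> \<Longrightarrow>
      sem_eq \<Omega> \<rho> (f \<star> (\<alpha> \<star> ell_minus I + (\<beta>\<^sub>2 + \<beta>\<^sub>3 \<star> cst I) \<star> cst J) \<star> star_inv \<Omega> f) \<longleftrightarrow>
      (\<forall>\<^sub>\<approx>z\<in>D. R z = biconjugate (F z) (biframe I J (two_sided_form (a z) (b2 z) (b3 z))))"
  unfolding normal_form_biconjugate [OF IJ, symmetric]
  by (rule sem_eq_iff, rule \<sigma> \<rho>, intro has_stem_intros has_stem_star_inv f; assumption)+

lemma biquat_of_of_real: "biquat_of (of_real r) = biscalar (of_real r)"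
  by (simp add: biquat_eq_iff)

lemma biscalar_eq_iff: "biscalar a = biscalar b \<longleftrightarrow> a = b"
  by (simp add: biquat_eq_iff)

lemma SEM_R_biscalar_lift:
  assumes "a meromorphic_on D"
  shows "biquat_lift (\<lambda>z. biscalar (a z)) \<in> SEM_R \<Omega>"
    and "has_stem (biquat_lift (\<lambda>z. biscalar (a z))) (\<lambda>z. biscalar (a z))"
proof -
  show *: "has_stem (biquat_lift (\<lambda>z. biscalar (a z))) (\<lambda>z. biscalar (a z))"
    using assms by (intro has_stem_biquat_lift bimero_intros)
  then show "biquat_lift (\<lambda>z. biscalar (a z)) \<in> SEM_R \<Omega>"
    by (rule has_stem_SEM_R)
qed

lemma sem_eq_scalar_iff:
  assumes "has_stem \<alpha> (\<lambda>z. biscalar (a z))"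
  shows "sem_eq \<Omega> \<alpha> 1 \<longleftrightarrow> (\<forall>\<^sub>\<approx>z\<in>D. a z = 1)"
    and "sem_eq \<Omega> \<alpha> (cst (1 / 2)) \<longleftrightarrow> (\<forall>\<^sub>\<approx>z\<in>D. a z = 1 / 2)"
    and "sem_eq \<Omega> (\<alpha> \<star> \<alpha>) (cst (- (1 / 4))) \<longleftrightarrow> (\<forall>\<^sub>\<approx>z\<in>D. a z * a z = - (1 / 4))"
    and "has_stem \<beta> (\<lambda>z. biscalar (b z)) \<Longrightarrow>
      sem_eq \<Omega> (\<alpha> \<star> \<alpha> + \<beta> \<star> \<beta>) 0 \<longleftrightarrow> (\<forall>\<^sub>\<approx>z\<in>D. a z * a z + b z * b z = 0)"
proof -
  have q: "biquat_of (1 / 2) = biscalar (1 / 2)" "biquat_of (- (1 / 4)) = biscalar (- (1 / 4))"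
  proof -
    have "(1 / 2 :: quat) = of_real (1 / 2)" "- (1 / 4 :: quat) = of_real (- (1 / 4))"
      unfolding divide_inverse by simp_all
    then show "biquat_of (1 / 2) = biscalar (1 / 2)" "biquat_of (- (1 / 4)) = biscalar (- (1 / 4))"
      by (metis biquat_of_of_real of_real_1 of_real_divide of_real_minus of_real_numeral)+
  qed
  show "sem_eq \<Omega> \<alpha> 1 \<longleftrightarrow> (\<forall>\<^sub>\<approx>z\<in>D. a z = 1)"
    by (subst sem_eq_iff [OF assms has_stem_1]) (simp add: biquat_eq_iff)
  show "sem_eq \<Omega> \<alpha> (cst (1 / 2)) \<longleftrightarrow> (\<forall>\<^sub>\<approx>z\<in>D. a z = 1 / 2)"
    by (subst sem_eq_iff [OF assms has_stem_cst]) (simp add: q biscalar_eq_iff)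
  show "sem_eq \<Omega> (\<alpha> \<star> \<alpha>) (cst (- (1 / 4))) \<longleftrightarrow> (\<forall>\<^sub>\<approx>z\<in>D. a z * a z = - (1 / 4))"
    by (subst sem_eq_iff [OF has_stem_star [OF assms assms] has_stem_cst])
      (simp add: q biscalar_eq_iff flip: biscalar_mult)
  show "sem_eq \<Omega> (\<alpha> \<star> \<alpha> + \<beta> \<star> \<beta>) 0 \<longleftrightarrow> (\<forall>\<^sub>\<approx>z\<in>D. a z * a z + b z * b z = 0)"
    if \<beta>: "has_stem \<beta> (\<lambda>z. biscalar (b z))"
    by (subst sem_eq_iff [OF has_stem_add [OF has_stem_star [OF assms assms]
        has_stem_star [OF \<beta> \<beta>]] has_stem_0]) (simp add: biquat_eq_iff)
qed

text \<open>The frame can always be taken to be \<open>i\<close>, \<open>j\<close>: all the freedom is in \<open>f\<close>.  In that frame the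
  conjugated \<open>\<rho>\<close> is annihilated by \<open>lp\<close>, and its coefficients are read off its components.\<close>
lemma star_annihilator_iff:
  assumes \<sigma>: "has_stem \<sigma> S" "star_idempotent \<Omega> \<sigma>" and \<rho>: "has_stem \<rho> R"
  shows "sem_eq \<Omega> (\<sigma> \<star> \<rho>) 0 \<longleftrightarrow>
    (\<exists>I\<in>\<S>. \<exists>J\<in>\<S>. \<exists>\<alpha>\<in>SEM_R \<Omega>. \<exists>\<beta>\<in>SEM_R \<Omega>. \<exists>f.
      orthogonal I J \<and> star_invertible \<Omega> f \<and>
      sem_eq \<Omega> \<sigma> (f \<star> ell_plus I \<star> star_inv \<Omega> f) \<and>
      sem_eq \<Omega> \<rho> (f \<star> ell_minus I \<star> (\<alpha> + \<beta> \<star> cst J) \<star> star_inv \<Omega> f))"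
    (is "?L \<longleftrightarrow> ?R")
proof
  have L: "?L \<longleftrightarrow> (\<forall>\<^sub>\<approx>z\<in>D. S z * R z = 0)"
    by (rule sem_eq_iff; (rule has_stem_star has_stem_0 has_stem_reg_conj \<sigma> \<rho>)+)
  {
    assume ?L
    with L have ev: "\<forall>\<^sub>\<approx>z\<in>D. S z * R z = 0" by simp
    obtain f F X where f: "has_stem f F" "star_invertible \<Omega> f" and X: "bimero X D"
      and FX: "\<forall>\<^sub>\<approx>z\<in>D. binorm (F z) \<noteq> 0 \<and> S z = biconjugate (F z) lp \<and>
        R z = biconjugate (F z) (X z)"
      using star_idempotent_common_conjugation [OF \<sigma> \<rho>] .
    define a where "a z = bq0 (X z) - \<i> * bq1 (X z)" for z
    define b where "b z = bq2 (X z) - \<i> * bq3 (X z)" for z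
    have mero: "a meromorphic_on D" "b meromorphic_on D"
      unfolding a_def b_def by (intro meromorphic_intros bimero_component X)+
    have "\<forall>\<^sub>\<approx>z\<in>D. S z = biconjugate (F z) lp \<and> R z = biconjugate (F z) (left_form (a z) (b z))"
      using FX ev
    proof eventually_elim
      case (elim z)
      then have "lp * X z = 0"
        by (simp add: biconj_biconjugate biconj_lp biconjugate_mult biconjugate_eq_iff(2))
      then have "X z = left_form (a z) (b z)"
        unfolding a_def b_def by (rule iffD1 [OF annihilated_iff_form(1)])
      with elim show ?case by metis
    qed
    then have ev': "\<forall>\<^sub>\<approx>z\<in>D. S z = biconjugate (F z) lp"
      "\<forall>\<^sub>\<approx>z\<in>D. R z = biconjugate (F z) (left_form (a z) (b z))"
      by (simp_all add: eventually_conj_iff)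
    note nf = normal_form_stem_iff [OF \<sigma>(1) \<rho> f(1) qi_imag_unit qj_imag_unit orthogonal_qi_qj,
        unfolded biframe_id]
    have "sem_eq \<Omega> \<sigma> (f \<star> ell_plus qi \<star> star_inv \<Omega> f)"
      by (rule iffD2 [OF nf(1) ev'(1)])
    moreover have "sem_eq \<Omega> \<rho>
        (f \<star> ell_minus qi \<star> (biquat_lift (\<lambda>z. biscalar (a z)) +
          biquat_lift (\<lambda>z. biscalar (b z)) \<star> cst qj)
          \<star> star_inv \<Omega> f)"
      by (rule iffD2 [OF nf(2) [OF mero [THEN SEM_R_biscalar_lift(2)]] ev'(2)])
    ultimately show ?R
      by - (rule bexI [OF _ qi_imag_unit], rule bexI [OF _ qj_imag_unit],
        rule bexI [OF _ SEM_R_biscalar_lift(1) [OF mero(1)]],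
        rule bexI [OF _ SEM_R_biscalar_lift(1) [OF mero(2)]], rule exI [where x = f],
        intro conjI; (rule orthogonal_qi_qj f(2) | assumption))
  }
  assume ?R
  then show ?L
  proof (elim bexE exE conjE)
    fix I J \<alpha> \<beta> f
    assume IJ0: "I \<in> \<S>" "J \<in> \<S>" and mem: "\<alpha> \<in> SEM_R \<Omega>" "\<beta> \<in> SEM_R \<Omega>"
      and o: "orthogonal I J" and f: "star_invertible \<Omega> f"
      and eq: "sem_eq \<Omega> \<sigma> (f \<star> ell_plus I \<star> star_inv \<Omega> f)"
        "sem_eq \<Omega> \<rho> (f \<star> ell_minus I \<star> (\<alpha> + \<beta> \<star> cst J) \<star> star_inv \<Omega> f)"
    note IJ = IJ0 o
    obtain a b where scalars: "has_stem \<alpha> (\<lambda>z. biscalar (a z))"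
      "has_stem \<beta> (\<lambda>z. biscalar (b z))"
      using mem SEM_R_has_stem by metis
    note F = star_invertible_has_stem [OF f]
    note nf = normal_form_stem_iff [OF \<sigma>(1) \<rho> F(1) IJ]
    have "\<forall>\<^sub>\<approx>z\<in>D. S z * R z = 0"
      using F(2) iffD1 [OF nf(1) eq(1)] iffD1 [OF nf(2) [OF scalars] eq(2)]
      by eventually_elim
        (simp add: biconj_biconjugate biconj_biframe [OF IJ] biconj_lp biconjugate_mult
          annihilated_form biconjugate_eq_iff(2) biframe_simps [OF IJ] flip: biframe_mult [OF IJ])
    with L show ?L by simp
  qed
qed

lemma star_annihilator_idempotent_iff:
  assumes \<sigma>: "has_stem \<sigma> S" and \<rho>: "has_stem \<rho> R"
    and IJ: "I \<in> \<S>" "J \<in> \<S>" "orthogonal I J" and f: "star_invertible \<Omega> f"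
    and mem: "\<alpha> \<in> SEM_R \<Omega>" "\<beta> \<in> SEM_R \<Omega>"
    and eq: "sem_eq \<Omega> \<rho> (f \<star> ell_minus I \<star> (\<alpha> + \<beta> \<star> cst J) \<star> star_inv \<Omega> f)"
  shows "star_idempotent \<Omega> \<rho> \<longleftrightarrow> sem_eq \<Omega> \<alpha> 1"
proof -
  obtain a b where scalars: "has_stem \<alpha> (\<lambda>z. biscalar (a z))"
      "has_stem \<beta> (\<lambda>z. biscalar (b z))"
    and mero: "a meromorphic_on D" "b meromorphic_on D"
    using mem SEM_R_has_stem by metis
  note F = star_invertible_has_stem [OF f]
  let ?X = "\<lambda>z. left_form (a z) (b z)"
  have "\<forall>\<^sub>\<approx>z\<in>D. binorm (stem f z) \<noteq> 0 \<and> R z = biconjugate (stem f z) (biframe I J (?X z))"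
    using F(2) iffD1 [OF normal_form_stem_iff(2) [OF \<sigma> \<rho> F(1) IJ scalars] eq]
    by eventually_elim simp
  note id = star_idempotent_biconjugate_iff [OF \<rho> IJ this]
  have "star_idempotent \<Omega> \<rho> \<longleftrightarrow> (\<forall>\<^sub>\<approx>z\<in>D. a z = 1 \<and> True)"
    unfolding id
  proof (rule nontrivial_idempotent_alternative)
    show "a meromorphic_on D" by (rule mero)
    show "(\<lambda>z. bq0 (?X z)) meromorphic_on D"
      unfolding normal_form_sel biquat.sel by (intro meromorphic_intros mero)
    show "?X z * ?X z = ?X z \<longleftrightarrow> a z = 1 \<and> True \<or> ?X z = 0 \<or> ?X z = 1" for z
      using left_form_idempotent by (cases "?X z = 1") auto
    show False if "?X z = 0 \<or> ?X z = 1" "a z = 1" for z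
      using that by (auto simp: biquat_eq_iff normal_form_sel)
  qed
  then show ?thesis
    by (simp add: sem_eq_scalar_iff [OF scalars(1)] eventually_conj_iff)
qed

text \<open>The stem of \<open>\<sigma>\<^sup>c\<close> is \<open>lm\<close>, conjugated by the same \<open>F\<close>.\<close>
lemma star_conj_annihilator_iff:
  assumes \<sigma>: "has_stem \<sigma> S" "star_idempotent \<Omega> \<sigma>" and \<rho>: "has_stem \<rho> R"
  shows "sem_eq \<Omega> (\<sigma> \<star> \<rho> \<star> reg_conj \<Omega> \<sigma>) 0 \<longleftrightarrow>
    (\<exists>I\<in>\<S>. \<exists>J\<in>\<S>. \<exists>\<alpha>\<^sub>0\<in>SEM_R \<Omega>. \<exists>\<alpha>\<^sub>1\<in>SEM_R \<Omega>. \<exists>\<beta>\<in>SEM_R \<Omega>. \<exists>f.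
      orthogonal I J \<and> star_invertible \<Omega> f \<and>
      sem_eq \<Omega> \<sigma> (f \<star> ell_plus I \<star> star_inv \<Omega> f) \<and>
      sem_eq \<Omega> \<rho> (f \<star> (\<alpha>\<^sub>0 + \<alpha>\<^sub>1 \<star> cst I + \<beta> \<star> ell_minus I \<star> cst J) \<star> star_inv \<Omega> f))"
    (is "?L \<longleftrightarrow> ?R")
proof
  have L: "?L \<longleftrightarrow> (\<forall>\<^sub>\<approx>z\<in>D. S z * R z * biconj (S z) = 0)"
    by (rule sem_eq_iff; (rule has_stem_star has_stem_0 has_stem_reg_conj \<sigma> \<rho>)+)
  {
    assume ?L
    with L have ev: "\<forall>\<^sub>\<approx>z\<in>D. S z * R z * biconj (S z) = 0" by simp
    obtain f F X where f: "has_stem f F" "star_invertible \<Omega> f" and X: "bimero X D"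
      and FX: "\<forall>\<^sub>\<approx>z\<in>D. binorm (F z) \<noteq> 0 \<and> S z = biconjugate (F z) lp \<and>
        R z = biconjugate (F z) (X z)"
      using star_idempotent_common_conjugation [OF \<sigma> \<rho>] .
    define a0 where "a0 z = bq0 (X z)" for z
    define a1 where "a1 z = bq1 (X z)" for z
    define b where "b z = bq2 (X z) - \<i> * bq3 (X z)" for z
    have mero: "a0 meromorphic_on D" "a1 meromorphic_on D" "b meromorphic_on D"
      unfolding a0_def a1_def b_def by (intro meromorphic_intros bimero_component X)+
    have "\<forall>\<^sub>\<approx>z\<in>D. S z = biconjugate (F z) lp \<and> R z = biconjugate (F z) (conj_form (a0 z) (a1 z) (b z))"
      using FX ev
    proof eventually_elim
      case (elim z)
      then have "lp * X z * lm = 0"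
        by (simp add: biconj_biconjugate biconj_lp biconjugate_mult biconjugate_eq_iff(2))
      then have "X z = conj_form (a0 z) (a1 z) (b z)"
        unfolding a0_def a1_def b_def by (rule iffD1 [OF annihilated_iff_form(2)])
      with elim show ?case by metis
    qed
    then have ev': "\<forall>\<^sub>\<approx>z\<in>D. S z = biconjugate (F z) lp"
      "\<forall>\<^sub>\<approx>z\<in>D. R z = biconjugate (F z) (conj_form (a0 z) (a1 z) (b z))"
      by (simp_all add: eventually_conj_iff)
    note nf = normal_form_stem_iff [OF \<sigma>(1) \<rho> f(1) qi_imag_unit qj_imag_unit orthogonal_qi_qj,
        unfolded biframe_id]
    have "sem_eq \<Omega> \<sigma> (f \<star> ell_plus qi \<star> star_inv \<Omega> f)"
      by (rule iffD2 [OF nf(1) ev'(1)])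
    moreover have "sem_eq \<Omega> \<rho>
        (f \<star> (biquat_lift (\<lambda>z. biscalar (a0 z)) +
          biquat_lift (\<lambda>z. biscalar (a1 z)) \<star> cst qi +
          biquat_lift (\<lambda>z. biscalar (b z)) \<star> ell_minus qi \<star> cst qj)
          \<star> star_inv \<Omega> f)"
      by (rule iffD2 [OF nf(3) [OF mero [THEN SEM_R_biscalar_lift(2)]] ev'(2)])
    ultimately show ?R
      by - (rule bexI [OF _ qi_imag_unit], rule bexI [OF _ qj_imag_unit],
        rule bexI [OF _ SEM_R_biscalar_lift(1) [OF mero(1)]],
        rule bexI [OF _ SEM_R_biscalar_lift(1) [OF mero(2)]],
        rule bexI [OF _ SEM_R_biscalar_lift(1) [OF mero(3)]], rule exI [where x = f],
        intro conjI; (rule orthogonal_qi_qj f(2) | assumption))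
  }
  assume ?R
  then show ?L
  proof (elim bexE exE conjE)
    fix I J \<alpha>\<^sub>0 \<alpha>\<^sub>1 \<beta> f
    assume IJ0: "I \<in> \<S>" "J \<in> \<S>" and mem: "\<alpha>\<^sub>0 \<in> SEM_R \<Omega>" "\<alpha>\<^sub>1 \<in> SEM_R \<Omega>" "\<beta> \<in> SEM_R \<Omega>"
      and o: "orthogonal I J" and f: "star_invertible \<Omega> f"
      and eq: "sem_eq \<Omega> \<sigma> (f \<star> ell_plus I \<star> star_inv \<Omega> f)"
        "sem_eq \<Omega> \<rho> (f \<star> (\<alpha>\<^sub>0 + \<alpha>\<^sub>1 \<star> cst I + \<beta> \<star> ell_minus I \<star> cst J) \<star> star_inv \<Omega> f)"
    note IJ = IJ0 o
    obtain a0 a1 b where scalars: "has_stem \<alpha>\<^sub>0 (\<lambda>z. biscalar (a0 z))"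
      "has_stem \<alpha>\<^sub>1 (\<lambda>z. biscalar (a1 z))"
      "has_stem \<beta> (\<lambda>z. biscalar (b z))"
      using mem SEM_R_has_stem by metis
    note F = star_invertible_has_stem [OF f]
    note nf = normal_form_stem_iff [OF \<sigma>(1) \<rho> F(1) IJ]
    have "\<forall>\<^sub>\<approx>z\<in>D. S z * R z * biconj (S z) = 0"
      using F(2) iffD1 [OF nf(1) eq(1)] iffD1 [OF nf(3) [OF scalars] eq(2)]
      by eventually_elim
        (simp add: biconj_biconjugate biconj_biframe [OF IJ] biconj_lp biconjugate_mult
          annihilated_form biconjugate_eq_iff(2) biframe_simps [OF IJ] flip: biframe_mult [OF IJ])
    with L show ?L by simp
  qed
qed

lemma star_conj_annihilator_idempotent_iff:
  assumes \<sigma>: "has_stem \<sigma> S" and \<rho>: "has_stem \<rho> R"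
    and IJ: "I \<in> \<S>" "J \<in> \<S>" "orthogonal I J" and f: "star_invertible \<Omega> f"
    and mem: "\<alpha>\<^sub>0 \<in> SEM_R \<Omega>" "\<alpha>\<^sub>1 \<in> SEM_R \<Omega>" "\<beta> \<in> SEM_R \<Omega>"
    and eq: "sem_eq \<Omega> \<rho> (f \<star> (\<alpha>\<^sub>0 + \<alpha>\<^sub>1 \<star> cst I + \<beta> \<star> ell_minus I \<star> cst J) \<star> star_inv \<Omega> f)"
  shows "star_idempotent \<Omega> \<rho> \<longleftrightarrow> sem_eq \<Omega> \<alpha>\<^sub>0 (cst (1 / 2)) \<and> sem_eq \<Omega> (\<alpha>\<^sub>1 \<star> \<alpha>\<^sub>1) (cst (- (1 / 4)))"
proof -
  obtain a0 a1 b where scalars: "has_stem \<alpha>\<^sub>0 (\<lambda>z. biscalar (a0 z))"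
      "has_stem \<alpha>\<^sub>1 (\<lambda>z. biscalar (a1 z))"
      "has_stem \<beta> (\<lambda>z. biscalar (b z))"
    and mero: "a0 meromorphic_on D" "a1 meromorphic_on D" "b meromorphic_on D"
    using mem SEM_R_has_stem by metis
  note F = star_invertible_has_stem [OF f]
  let ?X = "\<lambda>z. conj_form (a0 z) (a1 z) (b z)"
  have "\<forall>\<^sub>\<approx>z\<in>D. binorm (stem f z) \<noteq> 0 \<and> R z = biconjugate (stem f z) (biframe I J (?X z))"
    using F(2) iffD1 [OF normal_form_stem_iff(3) [OF \<sigma> \<rho> F(1) IJ scalars] eq]
    by eventually_elim simp
  note id = star_idempotent_biconjugate_iff [OF \<rho> IJ this]
  have "star_idempotent \<Omega> \<rho> \<longleftrightarrow> (\<forall>\<^sub>\<approx>z\<in>D. a0 z = 1/2 \<and> a1 z * a1 z = - (1/4))"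
    unfolding id
  proof (rule nontrivial_idempotent_alternative)
    show "a0 meromorphic_on D" by (rule mero)
    show "(\<lambda>z. bq0 (?X z)) meromorphic_on D"
      unfolding normal_form_sel biquat.sel by (intro meromorphic_intros mero)
    show "?X z * ?X z = ?X z \<longleftrightarrow> a0 z = 1/2 \<and> a1 z * a1 z = - (1/4) \<or> ?X z = 0 \<or> ?X z = 1" for z
      using conj_form_idempotent by (cases "?X z = 1") auto
    show False if "?X z = 0 \<or> ?X z = 1" "a0 z = 1/2" for z
      using that by (auto simp: biquat_eq_iff normal_form_sel)
  qed
  then show ?thesis
    by (simp add: sem_eq_scalar_iff(2) [OF scalars(1)] sem_eq_scalar_iff(3) [OF scalars(2)] eventually_conj_iff)
qed

lemma star_two_sided_annihilator_iff:
  assumes \<sigma>: "has_stem \<sigma> S" "star_idempotent \<Omega> \<sigma>" and \<rho>: "has_stem \<rho> R"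
  shows "sem_eq \<Omega> (\<sigma> \<star> \<rho> \<star> \<sigma>) 0 \<longleftrightarrow>
    (\<exists>I\<in>\<S>. \<exists>J\<in>\<S>. \<exists>\<alpha>\<in>SEM_R \<Omega>. \<exists>\<beta>\<^sub>2\<in>SEM_R \<Omega>. \<exists>\<beta>\<^sub>3\<in>SEM_R \<Omega>. \<exists>f.
      orthogonal I J \<and> star_invertible \<Omega> f \<and>
      sem_eq \<Omega> \<sigma> (f \<star> ell_plus I \<star> star_inv \<Omega> f) \<and>
      sem_eq \<Omega> \<rho> (f \<star> (\<alpha> \<star> ell_minus I + (\<beta>\<^sub>2 + \<beta>\<^sub>3 \<star> cst I) \<star> cst J) \<star> star_inv \<Omega> f))"
    (is "?L \<longleftrightarrow> ?R")
proof
  have L: "?L \<longleftrightarrow> (\<forall>\<^sub>\<approx>z\<in>D. S z * R z * S z = 0)"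
    by (rule sem_eq_iff; (rule has_stem_star has_stem_0 has_stem_reg_conj \<sigma> \<rho>)+)
  {
    assume ?L
    with L have ev: "\<forall>\<^sub>\<approx>z\<in>D. S z * R z * S z = 0" by simp
    obtain f F X where f: "has_stem f F" "star_invertible \<Omega> f" and X: "bimero X D"
      and FX: "\<forall>\<^sub>\<approx>z\<in>D. binorm (F z) \<noteq> 0 \<and> S z = biconjugate (F z) lp \<and>
        R z = biconjugate (F z) (X z)"
      using star_idempotent_common_conjugation [OF \<sigma> \<rho>] .
    define a where "a z = bq0 (X z) - \<i> * bq1 (X z)" for z
    define b2 where "b2 z = bq2 (X z)" for z
    define b3 where "b3 z = bq3 (X z)" for z
    have mero: "a meromorphic_on D" "b2 meromorphic_on D" "b3 meromorphic_on D"
      unfolding a_def b2_def b3_def by (intro meromorphic_intros bimero_component X)+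
    have "\<forall>\<^sub>\<approx>z\<in>D. S z = biconjugate (F z) lp \<and> R z = biconjugate (F z) (two_sided_form (a z) (b2 z) (b3 z))"
      using FX ev
    proof eventually_elim
      case (elim z)
      then have "lp * X z * lp = 0"
        by (simp add: biconj_biconjugate biconj_lp biconjugate_mult biconjugate_eq_iff(2))
      then have "X z = two_sided_form (a z) (b2 z) (b3 z)"
        unfolding a_def b2_def b3_def by (rule iffD1 [OF annihilated_iff_form(3)])
      with elim show ?case by metis
    qed
    then have ev': "\<forall>\<^sub>\<approx>z\<in>D. S z = biconjugate (F z) lp"
      "\<forall>\<^sub>\<approx>z\<in>D. R z = biconjugate (F z) (two_sided_form (a z) (b2 z) (b3 z))"
      by (simp_all add: eventually_conj_iff)
    note nf = normal_form_stem_iff [OF \<sigma>(1) \<rho> f(1) qi_imag_unit qj_imag_unit orthogonal_qi_qj,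
        unfolded biframe_id]
    have "sem_eq \<Omega> \<sigma> (f \<star> ell_plus qi \<star> star_inv \<Omega> f)"
      by (rule iffD2 [OF nf(1) ev'(1)])
    moreover have "sem_eq \<Omega> \<rho>
        (f \<star> (biquat_lift (\<lambda>z. biscalar (a z)) \<star> ell_minus qi +
          (biquat_lift (\<lambda>z. biscalar (b2 z)) +
          biquat_lift (\<lambda>z. biscalar (b3 z)) \<star> cst qi) \<star> cst qj)
          \<star> star_inv \<Omega> f)"
      by (rule iffD2 [OF nf(4) [OF mero [THEN SEM_R_biscalar_lift(2)]] ev'(2)])
    ultimately show ?R
      by - (rule bexI [OF _ qi_imag_unit], rule bexI [OF _ qj_imag_unit],
        rule bexI [OF _ SEM_R_biscalar_lift(1) [OF mero(1)]],
        rule bexI [OF _ SEM_R_biscalar_lift(1) [OF mero(2)]],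
        rule bexI [OF _ SEM_R_biscalar_lift(1) [OF mero(3)]], rule exI [where x = f],
        intro conjI; (rule orthogonal_qi_qj f(2) | assumption))
  }
  assume ?R
  then show ?L
  proof (elim bexE exE conjE)
    fix I J \<alpha> \<beta>\<^sub>2 \<beta>\<^sub>3 f
    assume IJ0: "I \<in> \<S>" "J \<in> \<S>" and mem: "\<alpha> \<in> SEM_R \<Omega>" "\<beta>\<^sub>2 \<in> SEM_R \<Omega>" "\<beta>\<^sub>3 \<in> SEM_R \<Omega>"
      and o: "orthogonal I J" and f: "star_invertible \<Omega> f"
      and eq: "sem_eq \<Omega> \<sigma> (f \<star> ell_plus I \<star> star_inv \<Omega> f)"
        "sem_eq \<Omega> \<rho> (f \<star> (\<alpha> \<star> ell_minus I + (\<beta>\<^sub>2 + \<beta>\<^sub>3 \<star> cst I) \<star> cst J) \<star> star_inv \<Omega> f)"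
    note IJ = IJ0 o
    obtain a b2 b3 where scalars: "has_stem \<alpha> (\<lambda>z. biscalar (a z))"
      "has_stem \<beta>\<^sub>2 (\<lambda>z. biscalar (b2 z))"
      "has_stem \<beta>\<^sub>3 (\<lambda>z. biscalar (b3 z))"
      using mem SEM_R_has_stem by metis
    note F = star_invertible_has_stem [OF f]
    note nf = normal_form_stem_iff [OF \<sigma>(1) \<rho> F(1) IJ]
    have "\<forall>\<^sub>\<approx>z\<in>D. S z * R z * S z = 0"
      using F(2) iffD1 [OF nf(1) eq(1)] iffD1 [OF nf(4) [OF scalars] eq(2)]
      by eventually_elim
        (simp add: biconj_biconjugate biconj_biframe [OF IJ] biconj_lp biconjugate_mult
          annihilated_form biconjugate_eq_iff(2) biframe_simps [OF IJ] flip: biframe_mult [OF IJ])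
    with L show ?L by simp
  qed
qed

lemma star_two_sided_annihilator_idempotent_iff:
  assumes \<sigma>: "has_stem \<sigma> S" and \<rho>: "has_stem \<rho> R"
    and IJ: "I \<in> \<S>" "J \<in> \<S>" "orthogonal I J" and f: "star_invertible \<Omega> f"
    and mem: "\<alpha> \<in> SEM_R \<Omega>" "\<beta>\<^sub>2 \<in> SEM_R \<Omega>" "\<beta>\<^sub>3 \<in> SEM_R \<Omega>"
    and eq: "sem_eq \<Omega> \<rho> (f \<star> (\<alpha> \<star> ell_minus I + (\<beta>\<^sub>2 + \<beta>\<^sub>3 \<star> cst I) \<star> cst J) \<star> star_inv \<Omega> f)"
  shows "star_idempotent \<Omega> \<rho> \<longleftrightarrow> sem_eq \<Omega> \<alpha> 1 \<and> sem_eq \<Omega> (\<beta>\<^sub>2 \<star> \<beta>\<^sub>2 + \<beta>\<^sub>3 \<star> \<beta>\<^sub>3) 0"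
proof -
  obtain a b2 b3 where scalars: "has_stem \<alpha> (\<lambda>z. biscalar (a z))"
      "has_stem \<beta>\<^sub>2 (\<lambda>z. biscalar (b2 z))"
      "has_stem \<beta>\<^sub>3 (\<lambda>z. biscalar (b3 z))"
    and mero: "a meromorphic_on D" "b2 meromorphic_on D" "b3 meromorphic_on D"
    using mem SEM_R_has_stem by metis
  note F = star_invertible_has_stem [OF f]
  let ?X = "\<lambda>z. two_sided_form (a z) (b2 z) (b3 z)"
  have "\<forall>\<^sub>\<approx>z\<in>D. binorm (stem f z) \<noteq> 0 \<and> R z = biconjugate (stem f z) (biframe I J (?X z))"
    using F(2) iffD1 [OF normal_form_stem_iff(4) [OF \<sigma> \<rho> F(1) IJ scalars] eq]
    by eventually_elim simp
  note id = star_idempotent_biconjugate_iff [OF \<rho> IJ this]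
  have "star_idempotent \<Omega> \<rho> \<longleftrightarrow> (\<forall>\<^sub>\<approx>z\<in>D. a z = 1 \<and> b2 z * b2 z + b3 z * b3 z = 0)"
    unfolding id
  proof (rule nontrivial_idempotent_alternative)
    show "a meromorphic_on D" by (rule mero)
    show "(\<lambda>z. bq0 (?X z)) meromorphic_on D"
      unfolding normal_form_sel biquat.sel by (intro meromorphic_intros mero)
    show "?X z * ?X z = ?X z \<longleftrightarrow> a z = 1 \<and> b2 z * b2 z + b3 z * b3 z = 0 \<or> ?X z = 0 \<or> ?X z = 1" for z
      using two_sided_form_idempotent by (cases "?X z = 1") auto
    show False if "?X z = 0 \<or> ?X z = 1" "a z = 1" for z
      using that by (auto simp: biquat_eq_iff normal_form_sel)
  qed
  then show ?thesis
    by (simp add: sem_eq_scalar_iff(1) [OF scalars(1)] sem_eq_scalar_iff(4) [OF scalars(2,3)] eventually_conj_iff)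
qed

end

theorem theorem8p2:
  fixes \<Omega> :: "quat set" and \<sigma> \<rho> :: "quat \<Rightarrow> quat"
  assumes "product_domain \<Omega>"
    and "\<sigma> \<in> SR \<Omega>" and "star_idempotent \<Omega> \<sigma>"
    and "\<rho> \<in> SEM \<Omega>"
  shows
    "((\<sigma> \<star> \<rho> \<simeq>\<^bsub>\<Omega>\<^esub> 0) \<longleftrightarrow>
        (\<exists>I\<in>\<S>. \<exists>J\<in>\<S>. \<exists>\<alpha>\<in>SEM_R \<Omega>. \<exists>\<beta>\<in>SEM_R \<Omega>. \<exists>f.
           orthogonal I J \<and> star_invertible \<Omega> f \<and>
           (\<sigma> \<simeq>\<^bsub>\<Omega>\<^esub> f \<star> ell_plus I \<star> star_inv \<Omega> f) \<and>
           (\<rho> \<simeq>\<^bsub>\<Omega>\<^esub> f \<star> ell_minus I \<star> (\<alpha> + \<beta> \<star> cst J) \<star> star_inv \<Omega> f))) \<and>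
     (\<forall>I\<in>\<S>. \<forall>J\<in>\<S>. \<forall>\<alpha>\<in>SEM_R \<Omega>. \<forall>\<beta>\<in>SEM_R \<Omega>. \<forall>f.
           orthogonal I J \<and> star_invertible \<Omega> f \<and>
           (\<sigma> \<simeq>\<^bsub>\<Omega>\<^esub> f \<star> ell_plus I \<star> star_inv \<Omega> f) \<and>
           (\<rho> \<simeq>\<^bsub>\<Omega>\<^esub> f \<star> ell_minus I \<star> (\<alpha> + \<beta> \<star> cst J) \<star> star_inv \<Omega> f)
         \<longrightarrow> (star_idempotent \<Omega> \<rho> \<longleftrightarrow> (\<alpha> \<simeq>\<^bsub>\<Omega>\<^esub> 1)))
     \<and>
     ((\<sigma> \<star> \<rho> \<star> reg_conj \<Omega> \<sigma> \<simeq>\<^bsub>\<Omega>\<^esub> 0) \<longleftrightarrow>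
        (\<exists>I\<in>\<S>. \<exists>J\<in>\<S>. \<exists>\<alpha>\<^sub>0\<in>SEM_R \<Omega>. \<exists>\<alpha>\<^sub>1\<in>SEM_R \<Omega>. \<exists>\<beta>\<in>SEM_R \<Omega>. \<exists>f.
           orthogonal I J \<and> star_invertible \<Omega> f \<and>
           (\<sigma> \<simeq>\<^bsub>\<Omega>\<^esub> f \<star> ell_plus I \<star> star_inv \<Omega> f) \<and>
           (\<rho> \<simeq>\<^bsub>\<Omega>\<^esub> f \<star> (\<alpha>\<^sub>0 + \<alpha>\<^sub>1 \<star> cst I + \<beta> \<star> ell_minus I \<star> cst J) \<star> star_inv \<Omega> f))) \<and>
     (\<forall>I\<in>\<S>. \<forall>J\<in>\<S>. \<forall>\<alpha>\<^sub>0\<in>SEM_R \<Omega>. \<forall>\<alpha>\<^sub>1\<in>SEM_R \<Omega>. \<forall>\<beta>\<in>SEM_R \<Omega>. \<forall>f.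
           orthogonal I J \<and> star_invertible \<Omega> f \<and>
           (\<sigma> \<simeq>\<^bsub>\<Omega>\<^esub> f \<star> ell_plus I \<star> star_inv \<Omega> f) \<and>
           (\<rho> \<simeq>\<^bsub>\<Omega>\<^esub> f \<star> (\<alpha>\<^sub>0 + \<alpha>\<^sub>1 \<star> cst I + \<beta> \<star> ell_minus I \<star> cst J) \<star> star_inv \<Omega> f)
         \<longrightarrow> (star_idempotent \<Omega> \<rho> \<longleftrightarrow>
                (\<alpha>\<^sub>0 \<simeq>\<^bsub>\<Omega>\<^esub> cst (1 / 2)) \<and> (\<alpha>\<^sub>1 \<star> \<alpha>\<^sub>1 \<simeq>\<^bsub>\<Omega>\<^esub> cst (- (1 / 4)))))
     \<and>
     ((\<sigma> \<star> \<rho> \<star> \<sigma> \<simeq>\<^bsub>\<Omega>\<^esub> 0) \<longleftrightarrow>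
        (\<exists>I\<in>\<S>. \<exists>J\<in>\<S>. \<exists>\<alpha>\<in>SEM_R \<Omega>. \<exists>\<beta>\<^sub>2\<in>SEM_R \<Omega>. \<exists>\<beta>\<^sub>3\<in>SEM_R \<Omega>. \<exists>f.
           orthogonal I J \<and> star_invertible \<Omega> f \<and>
           (\<sigma> \<simeq>\<^bsub>\<Omega>\<^esub> f \<star> ell_plus I \<star> star_inv \<Omega> f) \<and>
           (\<rho> \<simeq>\<^bsub>\<Omega>\<^esub> f \<star> (\<alpha> \<star> ell_minus I + (\<beta>\<^sub>2 + \<beta>\<^sub>3 \<star> cst I) \<star> cst J) \<star> star_inv \<Omega> f))) \<and>
     (\<forall>I\<in>\<S>. \<forall>J\<in>\<S>. \<forall>\<alpha>\<in>SEM_R \<Omega>. \<forall>\<beta>\<^sub>2\<in>SEM_R \<Omega>. \<forall>\<beta>\<^sub>3\<in>SEM_R \<Omega>. \<forall>f.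
           orthogonal I J \<and> star_invertible \<Omega> f \<and>
           (\<sigma> \<simeq>\<^bsub>\<Omega>\<^esub> f \<star> ell_plus I \<star> star_inv \<Omega> f) \<and>
           (\<rho> \<simeq>\<^bsub>\<Omega>\<^esub> f \<star> (\<alpha> \<star> ell_minus I + (\<beta>\<^sub>2 + \<beta>\<^sub>3 \<star> cst I) \<star> cst J) \<star> star_inv \<Omega> f)
         \<longrightarrow> (star_idempotent \<Omega> \<rho> \<longleftrightarrow>
                (\<alpha> \<simeq>\<^bsub>\<Omega>\<^esub> 1) \<and> (\<beta>\<^sub>2 \<star> \<beta>\<^sub>2 + \<beta>\<^sub>3 \<star> \<beta>\<^sub>3 \<simeq>\<^bsub>\<Omega>\<^esub> 0)))"
proof -
  interpret semi_regular_algebra \<Omega>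
    using assms(1) by unfold_locales
  have \<sigma>: "has_stem \<sigma> (stem \<sigma>)"
    using assms(3) by (simp add: star_idempotent_def SEM_has_stem)
  have \<rho>: "has_stem \<rho> (stem \<rho>)"
    using assms(4) by (rule SEM_has_stem)
  show ?thesis
    by (intro conjI; (rule star_annihilator_iff [OF \<sigma> assms(3) \<rho>]
        star_conj_annihilator_iff [OF \<sigma> assms(3) \<rho>]
        star_two_sided_annihilator_iff [OF \<sigma> assms(3) \<rho>] |
      (intro ballI allI impI, elim conjE,
        rule star_annihilator_idempotent_iff [OF \<sigma> \<rho>]
          star_conj_annihilator_idempotent_iff [OF \<sigma> \<rho>]
          star_two_sided_annihilator_idempotent_iff [OF \<sigma> \<rho>]; assumption)))
qed

end
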